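(* Let $N\in\{3,5\}$ and let $\mathcal{H}$ be a Poncelet family of convex $N$-gons interscribed between two homothetic, concentric ellipses $\mathcal{E}_H$ (outer) and $\mathcal{E}_h$ (inner), where $\mathcal{E}_H$ has semiaxes $a\ge b>0$. Let $f_{h,1},f_{h,2}$ be the foci of $\mathcal{E}_h$. For a polygon of $\mathcal{H}$, let $A_1$ (resp. $A_2$) denote the area of the harmonic polygon which is its polar image with respect to the unit circle centered at $f_{h,1}$ (resp. $f_{h,2}$). Then $1/A_1+1/A_2$ is invariant over the family $\mathcal{H}$ and is given by $$N=3:\quad \frac{1}{A_1}+\frac1{A_2}=\frac{\sqrt{3}}{18}\,\frac{b}{a}\,(a^2+3b^2),$$ $$N=5:\quad \frac{1}{A_1}+\frac1{A_2}=\frac{b}{40\sin(2\pi/5)\,a}\cdot\frac{\left(a^4+10a^2b^2+5b^4\right)\left(\sqrt5\,(a^2+3b^2)+5a^2+7b^2\right)}{5a^4+10a^2b^2+b^4}.$$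
   Context: An $N$-gon is interscribed between $\mathcal{E}_H$ and $\mathcal{E}_h$ if its vertices lie on $\mathcal{E}_H$ and its sides are tangent to $\mathcal{E}_h$. For convex $N$-gons and homothetic concentric ellipses the family is an affine image of the family of regular $N$-gons: choosing coordinates with common center $(0,0)$ and axes along the coordinate axes, and $\alpha=\pi/N$, $\mathcal{E}_h$ has semiaxes $a\cos\alpha$, $b\cos\alpha$, and the members of $\mathcal{H}$ have consecutive vertices $(a\cos(2\alpha i+t),b\sin(2\alpha i+t))$, $i=1,\dots,N$, $t\in\mathbb{R}$. The polar image of a polygon with respect to a circle is the polygon whose vertices are the poles of the sidelines of the original polygon (consecutive sides giving consecutive vertices), so that its sidelines are the polars of the original vertices. A polygon is harmonic if it is inscribed in a circle and has an interior point whose distance to each sideline is a fixed proportion of the corresponding sidelength. *)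

theory Defs
  imports "HOL-Analysis.Analysis"
begin

(* Centre c, semiaxes a and b in the orthonormal directions u and v. *)
definition ellipse :: "real^2 \<Rightarrow> real^2 \<Rightarrow> real^2 \<Rightarrow> real \<Rightarrow> real \<Rightarrow> (real^2) set" where
  "ellipse c u v a b = {x. (((x - c) \<bullet> u) / a)\<^sup>2 + (((x - c) \<bullet> v) / b)\<^sup>2 = 1}"

(* Meaningful for a >= b > 0, with u the direction of the major axis;
   a singleton when a = b. *)
definition ellipse_foci :: "real^2 \<Rightarrow> real^2 \<Rightarrow> real \<Rightarrow> real \<Rightarrow> (real^2) set" where
  "ellipse_foci c u a b =
     {c + sqrt (a\<^sup>2 - b\<^sup>2) *\<^sub>R u, c - sqrt (a\<^sup>2 - b\<^sup>2) *\<^sub>R u}"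

(* An N-gon is given by its consecutive vertices p 0, ..., p (N - 1), indices
   being read modulo N; the values p i with i >= N are irrelevant. *)
definition side :: "nat \<Rightarrow> (nat \<Rightarrow> real^2) \<Rightarrow> nat \<Rightarrow> (real^2) set" where
  "side N p i = closed_segment (p i) (p (Suc i mod N))"

definition sideline :: "nat \<Rightarrow> (nat \<Rightarrow> real^2) \<Rightarrow> nat \<Rightarrow> (real^2) set" where
  "sideline N p i = affine hull {p i, p (Suc i mod N)}"

definition side_length :: "nat \<Rightarrow> (nat \<Rightarrow> real^2) \<Rightarrow> nat \<Rightarrow> real" where
  "side_length N p i = dist (p i) (p (Suc i mod N))"

definition polygon_interior :: "nat \<Rightarrow> (nat \<Rightarrow> real^2) \<Rightarrow> (real^2) set" where
  "polygon_interior N p = inside (\<Union>i<N. side N p i)"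

definition polygon_area :: "nat \<Rightarrow> (nat \<Rightarrow> real^2) \<Rightarrow> real" where
  "polygon_area N p = measure lebesgue (polygon_interior N p)"

(* Every side being an edge of the convex hull excludes star polygons and
   three collinear vertices. *)
definition convex_polygon :: "nat \<Rightarrow> (nat \<Rightarrow> real^2) \<Rightarrow> bool" where
  "convex_polygon N p \<longleftrightarrow> 3 \<le> N \<and> inj_on p {..<N} \<and>
     (\<forall>i<N. side N p i edge_of (convex hull (p ` {..<N})))"

(* Tangency of a line L to a set E; used for ellipses only, where a line is
   tangent iff it meets the curve in exactly one point. *)
definition line_tangent :: "(real^2) set \<Rightarrow> (real^2) set \<Rightarrow> bool" where
  "line_tangent L E \<longleftrightarrow> (\<exists>!x. x \<in> L \<inter> E)"

definition interscribed :: "nat \<Rightarrow> (nat \<Rightarrow> real^2) \<Rightarrow> (real^2) set \<Rightarrow> (real^2) set \<Rightarrow> bool" where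
  "interscribed N p E\<^sub>H E\<^sub>h \<longleftrightarrow>
     (\<forall>i<N. p i \<in> E\<^sub>H) \<and> (\<forall>i<N. line_tangent (sideline N p i) E\<^sub>h)"

definition convex_poncelet_family :: "nat \<Rightarrow> (real^2) set \<Rightarrow> (real^2) set \<Rightarrow> (nat \<Rightarrow> real^2) set" where
  "convex_poncelet_family N E\<^sub>H E\<^sub>h = {p. convex_polygon N p \<and> interscribed N p E\<^sub>H E\<^sub>h}"

(* The polar line of q, for q different from f, with respect to the circle of
   radius r centred at f. *)
definition polar_line :: "real^2 \<Rightarrow> real \<Rightarrow> real^2 \<Rightarrow> (real^2) set" where
  "polar_line f r q = {x. (x - f) \<bullet> (q - f) = r\<^sup>2}"

(* Meaningful for lines L that do not pass through f. *)
definition pole :: "real^2 \<Rightarrow> real \<Rightarrow> (real^2) set \<Rightarrow> real^2" where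
  "pole f r L = (THE q. polar_line f r q = L)"

definition polar_image :: "nat \<Rightarrow> real^2 \<Rightarrow> real \<Rightarrow> (nat \<Rightarrow> real^2) \<Rightarrow> nat \<Rightarrow> real^2" where
  "polar_image N f r p = (\<lambda>i. pole f r (sideline N p i))"

definition harmonic_polygon :: "nat \<Rightarrow> (nat \<Rightarrow> real^2) \<Rightarrow> bool" where
  "harmonic_polygon N p \<longleftrightarrow>
     (\<exists>c r. r > 0 \<and> (\<forall>i<N. p i \<in> sphere c r)) \<and>
     (\<exists>K\<in>polygon_interior N p. \<exists>k. \<forall>i<N.
        infdist K (sideline N p i) = k * side_length N p i)"

end

theory Submission
  imports Defs
begin

text \<open>Two consecutive vertices of the family differ by a fixed eccentric angle, up to sign; since vertices
  are distinct the sign never changes, so the angle is \<open>2k\<pi>/N\<close>, and convexity excludes the pentagram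
  \<open>N = 5\<close>, \<open>k = 2\<close>. With \<open>\<kappa>\<^sup>2 = a\<^sup>2 - b\<^sup>2\<close> and focus \<open>f = c + r\<kappa>u\<close>, the poles of the sidelines lie on a
  circle; if \<open>\<phi>\<^sub>i\<close> are the eccentric angles of the contact points, consecutive poles span with \<open>f\<close> a
  triangle of area proportional to \<open>1 / (D\<^sub>i D\<^sub>i\<^sub>+\<^sub>1)\<close>, where \<open>D\<^sub>i = a - \<kappa> cos \<phi>\<^sub>i\<close>. Since \<open>D\<^sub>i D\<^sub>i\<^sub>+\<^sub>1\<close> is also the squared
  distance from \<open>f\<close> to the vertex dual to this side, the point \<open>f\<close> itself witnesses harmonicity. Hence
  \<open>1/A\<close> is a multiple of the product of the \<open>D\<^sub>i\<close> divided by a cyclic sum of products of \<open>N - 2\<close> consecutive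
  ones. That sum does not depend on the polygon, and the product depends on it only through an odd
  power of \<open>\<kappa>\<close>, which cancels when \<open>\<kappa>\<close> and \<open>-\<kappa>\<close> (the two foci) are added.\<close>

subsection \<open>Plane geometry and poles\<close>

definition cross2 :: "real^2 \<Rightarrow> real^2 \<Rightarrow> real" where
  "cross2 x y = x $ 1 * y $ 2 - x $ 2 * y $ 1"

lemma inner_real2: "x \<bullet> y = x $ 1 * y $ 1 + x $ 2 * y $ 2" for x y :: "real^2"
  by (simp add: inner_vec_def sum_2)

lemma real2_eq_iff: "x = y \<longleftrightarrow> x $ 1 = y $ 1 \<and> x $ 2 = y $ 2" for x y :: "real^2"
  by (simp add: vec_eq_iff forall_2)

lemma cross2_cramer:
  assumes "cross2 x y \<noteq> 0"
  shows "z = (cross2 z y / cross2 x y) *\<^sub>R x + (cross2 x z / cross2 x y) *\<^sub>R y"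
proof -
  have "z $ i * cross2 x y = cross2 z y * x $ i + cross2 x z * y $ i" for i
    using exhaust_2[of i] by (auto simp: cross2_def algebra_simps)
  thus ?thesis
    using assms by (simp add: vec_eq_iff eq_divide_eq flip: add_divide_distrib)
qed

text \<open>A vector orthogonal to \<open>d\<close> is a multiple of \<open>d\<close> turned by a
  right angle; crossing it with \<open>q\<close>, where \<open>q \<bullet> d = 1\<close>, recovers
  the factor. In the application \<open>w\<close> is an edge vector, \<open>d\<close> the dual
  normal of the edge and \<open>q\<close> an endpoint.\<close>

lemma cross2_of_orthogonal:
  fixes w d q :: "real^2"
  assumes "w \<bullet> d = 0" "q \<bullet> d = 1"
  shows "w $ 1 = - cross2 q w * d $ 2" "w $ 2 = cross2 q w * d $ 1"
proof -
  have w: "w $ 1 * d $ 1 + w $ 2 * d $ 2 = 0" and q: "q $ 1 * d $ 1 + q $ 2 * d $ 2 = 1"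
    using assms by (simp_all add: inner_real2)
  show "w $ 1 = - cross2 q w * d $ 2" "w $ 2 = cross2 q w * d $ 1"
    using w q unfolding cross2_def by algebra+
qed

lemma norm_of_orthogonal:
  fixes w d q :: "real^2"
  assumes "w \<bullet> d = 0" "q \<bullet> d = 1"
  shows "norm w = \<bar>cross2 q w\<bar> * norm d"
proof -
  have "w \<bullet> w = (cross2 q w)\<^sup>2 * (d \<bullet> d)"
    by (simp only: inner_real2 cross2_of_orthogonal(1)[OF assms] cross2_of_orthogonal(2)[OF assms])
      (simp add: algebra_simps power2_eq_square)
  hence "(norm w)\<^sup>2 = (\<bar>cross2 q w\<bar> * norm d)\<^sup>2"
    by (simp add: power2_norm_eq_inner power_mult_distrib)
  thus ?thesis by (rule power2_eq_imp_eq) simp_all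
qed

lemma orthogonal_parallel:
  fixes x y m :: "real^2"
  assumes "x \<bullet> m = 0" "y \<bullet> m = 0" "m \<noteq> 0" "y \<noteq> 0"
  obtains l where "x = l *\<^sub>R y"
proof
  have x: "x $ 1 * m $ 1 + x $ 2 * m $ 2 = 0" and y: "y $ 1 * m $ 1 + y $ 2 * m $ 2 = 0"
    using assms by (simp_all add: inner_real2)
  have "cross2 x y * m $ 1 = 0" "cross2 x y * m $ 2 = 0"
    unfolding cross2_def using x y by algebra+
  hence "cross2 x y = 0" using assms(3) by (auto simp: real2_eq_iff)
  moreover have "y \<bullet> y \<noteq> 0" using assms by simp
  ultimately show "x = ((x \<bullet> y) / (y \<bullet> y)) *\<^sub>R y"
  proof -
    assume cross: "cross2 x y = 0" and "y \<bullet> y \<noteq> 0"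
    have "(x \<bullet> y) * y $ 1 = (y \<bullet> y) * x $ 1" "(x \<bullet> y) * y $ 2 = (y \<bullet> y) * x $ 2"
      using cross unfolding inner_real2 cross2_def by algebra+
    with \<open>y \<bullet> y \<noteq> 0\<close> show ?thesis by (simp add: real2_eq_iff nonzero_eq_divide_eq mult.commute)
  qed
qed

lemma affine_hull_eq_hyperplane:
  fixes A B f m :: "real^2"
  assumes "(A - f) \<bullet> m = 1" "(B - f) \<bullet> m = 1" "A \<noteq> B"
  shows "affine hull {A, B} = {x. (x - f) \<bullet> m = 1}"
proof (intro set_eqI iffI)
  fix x assume "x \<in> affine hull {A, B}"
  then obtain s t where st: "s + t = 1" and x: "x = s *\<^sub>R A + t *\<^sub>R B"
    unfolding affine_hull_2 by auto
  have "x - f = s *\<^sub>R (A - f) + t *\<^sub>R (B - f)"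
    unfolding x using st by (simp add: algebra_simps flip: scaleR_add_left)
  hence "(x - f) \<bullet> m = s + t" by (simp add: inner_add_left assms)
  thus "x \<in> {x. (x - f) \<bullet> m = 1}" using st by simp
next
  fix x assume "x \<in> {x. (x - f) \<bullet> m = 1}"
  hence "(x - A) \<bullet> m = 0" "(B - A) \<bullet> m = 0" "m \<noteq> 0" "B - A \<noteq> 0"
    using assms by (auto simp: inner_diff_left)
  then obtain l where "x - A = l *\<^sub>R (B - A)" by (rule orthogonal_parallel)
  hence "x = (1 - l) *\<^sub>R A + l *\<^sub>R B" by (simp add: algebra_simps)
  thus "x \<in> affine hull {A, B}" unfolding affine_hull_2 by (intro CollectI exI[of _ "1 - l"] exI[of _ l]) simp
qed

text \<open>Putting the point of each hyperplane nearest to 0 into the equation of the other shows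
  that \<open>m \<bullet> m'\<close> equals both squared norms, so \<open>m - m'\<close> has norm
  0.\<close>

lemma inner_eq_1_unique:
  fixes m m' :: "'a::real_inner"
  assumes "m \<noteq> 0" "m' \<noteq> 0" "\<And>x. x \<bullet> m = 1 \<longleftrightarrow> x \<bullet> m' = 1"
  shows "m = m'"
proof -
  have "(m /\<^sub>R (m \<bullet> m)) \<bullet> m' = 1"
    unfolding assms(3) [symmetric] using assms(1) by simp
  moreover have "(m' /\<^sub>R (m' \<bullet> m')) \<bullet> m = 1"
    unfolding assms(3) using assms(2) by simp
  ultimately have "m \<bullet> m' = m \<bullet> m" "m' \<bullet> m = m' \<bullet> m'"
    using assms(1,2) by (simp_all add: field_simps)
  hence "(m - m') \<bullet> (m - m') = 0" by (simp add: inner_diff_left inner_diff_right inner_commute)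
  thus ?thesis by simp
qed

text \<open>Replaces the definite description in \<open>pole\<close> by two inner product equations:
  they say that the polar of \<open>q\<close> passes through \<open>A\<close> and \<open>B\<close>,
  and a line missing \<open>f\<close> has only one normal scaled to the value 1.\<close>

lemma pole_line:
  assumes "(A - f) \<bullet> (q - f) = 1" "(B - f) \<bullet> (q - f) = 1" "A \<noteq> B"
  shows "pole f 1 (affine hull {A, B}) = q"
  unfolding pole_def
proof (rule the_equality)
  have L: "affine hull {A, B} = {x. (x - f) \<bullet> (q - f) = 1}"
    by (rule affine_hull_eq_hyperplane [OF assms])
  thus "polar_line f 1 q = affine hull {A, B}"
    by (simp add: polar_line_def)
  fix q' assume "polar_line f 1 q' = affine hull {A, B}"
  hence eq: "(x - f) \<bullet> (q' - f) = 1 \<longleftrightarrow> (x - f) \<bullet> (q - f) = 1" for x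
    unfolding L polar_line_def by auto
  have "q' - f = q - f"
  proof (rule inner_eq_1_unique)
    show "q' - f \<noteq> 0" "q - f \<noteq> 0" using eq[of A] assms(1) by auto
    show "x \<bullet> (q' - f) = 1 \<longleftrightarrow> x \<bullet> (q - f) = 1" for x using eq[of "x + f"] by simp
  qed
  thus "q' = q" by simp
qed

lemma infdist_hyperplane:
  fixes d f :: "'a::real_inner"
  assumes "d \<noteq> 0"
  shows "infdist f {x. (x - f) \<bullet> d = 1} = 1 / norm d"
proof (rule antisym)
  let ?L = "{x. (x - f) \<bullet> d = 1}" and ?x = "f + d /\<^sub>R (d \<bullet> d)"
  have x: "?x \<in> ?L" using assms by simp
  have "dist f ?x = 1 / norm d"
    using assms by (simp add: dist_norm dot_square_norm power2_eq_square) (simp add: divide_simps)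
  with x show "infdist f ?L \<le> 1 / norm d"
    using infdist_le[OF x, of f] by simp
  have "1 / norm d \<le> dist f y" if "y \<in> ?L" for y
  proof -
    have "1 \<le> norm (y - f) * norm d"
      using norm_cauchy_schwarz[of "y - f" d] that by simp
    thus ?thesis using assms by (simp add: divide_le_eq dist_norm norm_minus_commute)
  qed
  moreover have "?L \<noteq> {}" using x by blast
  ultimately show "1 / norm d \<le> infdist f ?L"
    by (auto simp: infdist_def intro!: cINF_greatest)
qed

subsection \<open>Convex polygons given by polar duality\<close>

lemma cross2_diff_self: "cross2 x (y - x) = cross2 x y"
  by (simp add: cross2_def algebra_simps)

lemma Suc_mod_cycle:
  fixes i N :: nat
  assumes "3 \<le> N" "i < N"
  defines "k \<equiv> Suc i mod N"
  defines "l \<equiv> Suc k mod N"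
  shows "k < N" "l < N" "k \<noteq> i" "l \<noteq> k" "l \<noteq> i"
proof -
  have "k = (if Suc i = N then 0 else Suc i)" using assms by (simp add: k_def mod_Suc)
  moreover have "k < N" using assms by (simp add: k_def)
  moreover from this have "l = (if Suc k = N then 0 else Suc k)" by (simp add: l_def mod_Suc)
  ultimately show "k < N" "l < N" "k \<noteq> i" "l \<noteq> k" "l \<noteq> i" using assms(1,2) by (auto split: if_splits)
qed

lemma Suc_mod_surj:
  fixes k N :: nat
  assumes "k < N"
  obtains i where "i < N" "Suc i mod N = k"
proof (cases k)
  case 0
  thus ?thesis using assms that[of "N - 1"] by simp
next
  case (Suc m)
  thus ?thesis using assms that[of m] by simp
qed

lemma inner_diff_eq: "(x - y) \<bullet> m = m \<bullet> x - m \<bullet> y" for m :: "'a::real_inner"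
  by (simp add: inner_diff_left inner_diff_right inner_commute)

text \<open>The sideline through \<open>q (i - 1)\<close> and \<open>q i\<close> (indices modulo \<open>N\<close>) is \<open>{x. (x - f) \<bullet> d i = 1}\<close>, and the
  triangle over it is the part of the region on which the functional \<open>d i\<close> dominates the others.\<close>
locale polar_polygon =
  fixes N :: nat and f :: "real^2" and q d :: "nat \<Rightarrow> real^2"
  assumes N3: "3 \<le> N"
    and le1: "\<And>i j. i < N \<Longrightarrow> j < N \<Longrightarrow> (q j - f) \<bullet> d i \<le> 1"
    and eq1: "\<And>i j. i < N \<Longrightarrow> j < N \<Longrightarrow> (q j - f) \<bullet> d i = 1 \<longleftrightarrow> i = j \<or> i = Suc j mod N"
begin

text \<open>The solid polygon is given by half-planes and not as a convex hull, so that convexity,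
  interior and frontier can be read off from the functionals \<open>d i\<close>.\<close>

definition region :: "(real^2) set" where
  "region = {x. \<forall>i<N. (x - f) \<bullet> d i \<le> 1}"

definition sector :: "nat \<Rightarrow> (real^2) set" where
  "sector i = convex hull {f, q i, q (Suc i mod N)}"

text \<open>Three consecutive indices are distinct because \<open>3 \<le> N\<close>; together with
  \<open>eq1\<close> this makes the last two inequalities strict.\<close>

lemma incidences:
  assumes "i < N"
  defines "k \<equiv> Suc i mod N"
  defines "l \<equiv> Suc k mod N"
  shows "k < N" "l < N" "(q i - f) \<bullet> d i = 1" "(q i - f) \<bullet> d k = 1" "(q k - f) \<bullet> d k = 1"
    "(q k - f) \<bullet> d l = 1" "(q i - f) \<bullet> d l < 1" "(q k - f) \<bullet> d i < 1"
proof -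
  note c = Suc_mod_cycle[OF N3 assms(1), folded k_def l_def]
  show "k < N" "l < N" "(q i - f) \<bullet> d i = 1" "(q i - f) \<bullet> d k = 1" "(q k - f) \<bullet> d k = 1"
    "(q k - f) \<bullet> d l = 1"
    using c assms(1) by (simp_all add: eq1) (simp_all add: k_def l_def)
  have "(q i - f) \<bullet> d l \<noteq> 1" "(q k - f) \<bullet> d i \<noteq> 1"
    using c assms(1) by (simp_all add: eq1 flip: k_def l_def)
  thus "(q i - f) \<bullet> d l < 1" "(q k - f) \<bullet> d i < 1"
    using le1 c assms(1) by (simp_all add: order_less_le)
qed

text \<open>The edge vector is orthogonal to \<open>d k\<close>, so a vanishing cross product would
  make it 0; but \<open>d i\<close> separates the two endpoints.\<close>

lemma cross2_vertices_nonzero: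
  assumes "i < N"
  shows "cross2 (q i - f) (q (Suc i mod N) - f) \<noteq> 0"
proof
  define k where "k = Suc i mod N"
  note inc = incidences[OF assms, folded k_def]
  assume "cross2 (q i - f) (q (Suc i mod N) - f) = 0"
  hence "cross2 (q i - f) (q k - q i) = 0"
    using cross2_diff_self[of "q i - f" "q k - f"] by (simp add: k_def)
  hence "q k - q i = 0"
    using cross2_of_orthogonal[of "q k - q i" "d k" "q i - f"] inc(4,5)
    by (simp add: inner_diff_left real2_eq_iff)
  thus False using inc(3,8) by simp
qed

lemma sector_eq:
  "sector i = {f + s *\<^sub>R (q i - f) + t *\<^sub>R (q (Suc i mod N) - f) | s t. 0 \<le> s \<and> 0 \<le> t \<and> s + t \<le> 1}"
  unfolding sector_def by (rule convex_hull_3_alt)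

text \<open>In the coordinates \<open>s\<close>, \<open>t\<close> the functional of the edge takes
  the value \<open>s + t\<close>, the largest that \<open>le1\<close> permits.\<close>

lemma sector_dominant:
  assumes "i < N" "j < N" "x \<in> sector i"
  shows "(x - f) \<bullet> d j \<le> (x - f) \<bullet> d (Suc i mod N)" "(x - f) \<bullet> d j \<le> 1"
proof -
  define k where "k = Suc i mod N"
  obtain s t where st: "0 \<le> s" "0 \<le> t" "s + t \<le> 1" and x: "x = f + s *\<^sub>R (q i - f) + t *\<^sub>R (q k - f)"
    using assms(3) unfolding sector_eq k_def by auto
  note inc = incidences[OF assms(1), folded k_def]
  have e: "(x - f) \<bullet> m = s * ((q i - f) \<bullet> m) + t * ((q k - f) \<bullet> m)" for m
    unfolding x by (simp add: inner_add_left)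
  have "(x - f) \<bullet> d j \<le> s * 1 + t * 1"
    unfolding e using assms inc st le1 by (intro add_mono mult_left_mono) auto
  moreover have "(x - f) \<bullet> d k = s + t" unfolding e using inc by simp
  ultimately show "(x - f) \<bullet> d j \<le> (x - f) \<bullet> d (Suc i mod N)" "(x - f) \<bullet> d j \<le> 1"
    using st by (simp_all add: k_def)
qed

lemma sector_subset_region: "i < N \<Longrightarrow> sector i \<subseteq> region"
  using sector_dominant(2) by (auto simp: region_def)

text \<open>Expand \<open>x - f\<close> in the two vertex vectors. Comparing \<open>d k\<close> with
  its neighbour \<open>d i\<close> gives \<open>0 \<le> t\<close>, comparing it with
  \<open>d l\<close> gives \<open>0 \<le> s\<close>, and the bound 1 gives
  \<open>s + t \<le> 1\<close>.\<close>

lemma in_sector_if_dominant: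
  assumes i: "i < N" and x: "x \<in> region"
    and dom: "\<And>j. j < N \<Longrightarrow> (x - f) \<bullet> d j \<le> (x - f) \<bullet> d (Suc i mod N)"
  shows "x \<in> sector i"
proof -
  define k l where "k = Suc i mod N" and "l = Suc k mod N"
  note inc = incidences[OF i, folded k_def l_def, folded l_def]
  obtain s t where xf: "x - f = s *\<^sub>R (q i - f) + t *\<^sub>R (q k - f)"
    using cross2_cramer[OF cross2_vertices_nonzero[OF i]] unfolding k_def by blast
  have e: "(x - f) \<bullet> m = s * ((q i - f) \<bullet> m) + t * ((q k - f) \<bullet> m)" for m
    unfolding xf by (simp add: inner_add_left)
  have "x = f + (x - f)" by simp
  hence x': "x = f + s *\<^sub>R (q i - f) + t *\<^sub>R (q k - f)" unfolding xf by (simp only: add.assoc)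
  have "(x - f) \<bullet> d k = s + t" "(x - f) \<bullet> d i = s + t * ((q k - f) \<bullet> d i)"
    "(x - f) \<bullet> d l = s * ((q i - f) \<bullet> d l) + t"
    unfolding e using inc by simp_all
  moreover have "(x - f) \<bullet> d i \<le> (x - f) \<bullet> d k" "(x - f) \<bullet> d l \<le> (x - f) \<bullet> d k" "(x - f) \<bullet> d k \<le> 1"
    using dom i inc x by (auto simp: k_def region_def)
  ultimately have "t * (1 - (q k - f) \<bullet> d i) \<ge> 0" "s * (1 - (q i - f) \<bullet> d l) \<ge> 0" "s + t \<le> 1"
    by (simp_all add: algebra_simps)
  moreover have "1 - (q k - f) \<bullet> d i > 0" "1 - (q i - f) \<bullet> d l > 0" using inc by simp_all
  ultimately have "0 \<le> t" "0 \<le> s" "s + t \<le> 1" by (auto simp: zero_le_mult_iff)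
  thus ?thesis unfolding sector_eq using x' by (auto simp: k_def)
qed

lemma region_eq_sectors: "region = (\<Union>i<N. sector i)"
proof
  show "(\<Union>i<N. sector i) \<subseteq> region" using sector_subset_region by auto
  show "region \<subseteq> (\<Union>i<N. sector i)"
  proof
    fix x assume x: "x \<in> region"
    let ?S = "(\<lambda>j. (x - f) \<bullet> d j) ` {..<N}"
    have "Max ?S \<in> ?S" using N3 by (intro Max_in) (auto simp: lessThan_empty_iff)
    then obtain k where k: "k < N" "Max ?S = (x - f) \<bullet> d k" by auto
    obtain i where i: "i < N" "Suc i mod N = k" using Suc_mod_surj[OF k(1)] .
    have "(x - f) \<bullet> d j \<le> (x - f) \<bullet> d k" if "j < N" for j
      unfolding k(2)[symmetric] using that by (intro Max_ge) auto
    hence "x \<in> sector i" using in_sector_if_dominant i x by metis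
    thus "x \<in> (\<Union>i<N. sector i)" using i by auto
  qed
qed

section \<open>Topology of the region: compactness, interior, frontier\<close>

lemma compact_sector: "compact (sector i)"
  unfolding sector_def by (intro finite_imp_compact_convex_hull) auto

text \<open>Boundedness is not visible from the half-planes; it comes from the decomposition into
  finitely many triangles.\<close>

lemma compact_region: "compact region"
  unfolding region_eq_sectors using compact_sector by (intro compact_UN) auto

lemma convex_region: "convex region"
proof -
  have "region = (\<Inter>i\<in>{..<N}. {x. d i \<bullet> x \<le> 1 + d i \<bullet> f})"
    by (auto simp: region_def inner_diff_eq algebra_simps)
  thus ?thesis by (simp add: convex_INT convex_halfspace_le)
qed

lemma d_nonzero: "i < N \<Longrightarrow> d i \<noteq> 0"
  using incidences(3)[of i] by auto

lemma open_strict_region: "open {x. \<forall>i<N. (x - f) \<bullet> d i < 1}"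
proof -
  have "{x. \<forall>i<N. (x - f) \<bullet> d i < 1} = (\<Inter>i\<in>{..<N}. {x. d i \<bullet> x < 1 + d i \<bullet> f})"
    by (auto simp: inner_diff_eq algebra_simps)
  thus ?thesis by (simp add: open_INT open_halfspace_lt)
qed

lemma interior_region: "interior region = {x. \<forall>i<N. (x - f) \<bullet> d i < 1}"
proof
  show "{x. \<forall>i<N. (x - f) \<bullet> d i < 1} \<subseteq> interior region"
    using open_strict_region by (intro interior_maximal) (auto simp: region_def intro: less_imp_le)
  have "interior region \<subseteq> {x. (x - f) \<bullet> d i < 1}" if i: "i < N" for i
  proof -
    have "region \<subseteq> {x. d i \<bullet> x \<le> 1 + d i \<bullet> f}"
      using i by (auto simp: region_def inner_diff_eq algebra_simps)
    hence "interior region \<subseteq> interior {x. d i \<bullet> x \<le> 1 + d i \<bullet> f}" by (rule interior_mono)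
    also have "\<dots> = {x. (x - f) \<bullet> d i < 1}"
      using d_nonzero[OF i] by (simp add: inner_diff_eq algebra_simps)
    finally show ?thesis .
  qed
  thus "interior region \<subseteq> {x. \<forall>i<N. (x - f) \<bullet> d i < 1}" by blast
qed

text \<open>At a frontier point some \<open>d k\<close> attains the maximal value 1, so the point
  lies in the sector of that edge; there \<open>s + t = 1\<close> puts it on the side.\<close>

lemma frontier_region: "frontier region = (\<Union>i<N. side N q i)"
proof -
  have "closed region" using compact_region by (rule compact_imp_closed)
  hence fr: "frontier region = {x \<in> region. \<exists>k<N. (x - f) \<bullet> d k = 1}"
    unfolding frontier_def closure_closed[OF \<open>closed region\<close>] interior_region
    by (auto simp: region_def not_less intro: antisym) (metis antisym)
  have sub: "side N q i \<subseteq> frontier region" if i: "i < N" for i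
  proof
    fix x assume x: "x \<in> side N q i"
    note inc = incidences[OF i]
    have "q i \<in> region" "q (Suc i mod N) \<in> region" using le1 i inc(1) by (auto simp: region_def)
    hence "x \<in> region" using x closed_segment_subset[OF _ _ convex_region] unfolding side_def by blast
    obtain t where "x = (1 - t) *\<^sub>R q i + t *\<^sub>R q (Suc i mod N)"
      using x by (auto simp: side_def in_segment)
    hence "x - f = (1 - t) *\<^sub>R (q i - f) + t *\<^sub>R (q (Suc i mod N) - f)" by (simp add: algebra_simps)
    hence "(x - f) \<bullet> d (Suc i mod N) = 1" using inc by (simp add: inner_add_left)
    with \<open>x \<in> region\<close> show "x \<in> frontier region" using inc(1) unfolding fr by blast
  qed
  have "x \<in> (\<Union>i<N. side N q i)" if x: "x \<in> frontier region" for x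
  proof -
    obtain k where k: "k < N" "(x - f) \<bullet> d k = 1" and x: "x \<in> region" using x unfolding fr by blast
    obtain i where i: "i < N" "Suc i mod N = k" using Suc_mod_surj[OF k(1)] .
    note inc = incidences[OF i(1), unfolded i(2)]
    have "x \<in> sector i"
      using x k(2) i(2) by (intro in_sector_if_dominant i(1)) (simp_all add: region_def)
    then obtain s t where st: "0 \<le> s" "0 \<le> t" and x: "x = f + s *\<^sub>R (q i - f) + t *\<^sub>R (q k - f)"
      unfolding sector_eq i by auto
    have "(x - f) \<bullet> d k = s * ((q i - f) \<bullet> d k) + t * ((q k - f) \<bullet> d k)"
      unfolding x by (simp add: inner_add_left)
    hence s: "s = 1 - t" using inc k by simp
    have "x = (1 - t) *\<^sub>R q i + t *\<^sub>R q k" unfolding x s by (simp add: algebra_simps)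
    hence "x \<in> side N q i" using st s unfolding side_def in_segment i by (intro conjI exI[of _ t]) auto
    thus ?thesis using i by blast
  qed
  with sub show ?thesis by blast
qed

lemma polygon_interior_eq: "polygon_interior N q = interior region"
  unfolding polygon_interior_def frontier_region [symmetric]
  using convex_region compact_region by (intro inside_frontier_eq_interior compact_imp_bounded)

lemma f_in_polygon_interior: "f \<in> polygon_interior N q"
  by (simp add: polygon_interior_eq interior_region)

section \<open>Area, sidelines and side lengths\<close>

lemma negligible_sector_Int:
  assumes "i < N" "j < N" "i \<noteq> j"
  shows "negligible (sector i \<inter> sector j)"
proof -
  define k l where "k = Suc i mod N" and "l = Suc j mod N"
  note inc = incidences(1)[OF assms(1), folded k_def] incidences(1)[OF assms(2), folded l_def]
  have "k \<noteq> l" using assms by (auto simp: k_def l_def mod_Suc split: if_splits)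
  \<comment> \<open>Equal functionals would make \<open>k\<close> and \<open>l\<close> successors of
    each other, which \<open>3 \<le> N\<close> excludes.\<close>
  have "d k \<noteq> d l"
  proof
    assume "d k = d l"
    moreover have "(q k - f) \<bullet> d k = 1" "(q l - f) \<bullet> d l = 1" using inc by (simp_all add: eq1)
    ultimately have "(q k - f) \<bullet> d l = 1" "(q l - f) \<bullet> d k = 1" by simp_all
    hence "l = Suc k mod N" "k = Suc l mod N" using inc \<open>k \<noteq> l\<close> eq1[of l k] eq1[of k l] by simp_all
    thus False using Suc_mod_cycle(5)[OF N3 inc(1)] by simp
  qed
  \<comment> \<open>On each sector its own functional is the largest, so on the overlap the two
    agree; this confines it to a line.\<close>
  have "sector i \<inter> sector j \<subseteq> {x. (d k - d l) \<bullet> x = (d k - d l) \<bullet> f}"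
  proof
    fix x assume x: "x \<in> sector i \<inter> sector j"
    have "(x - f) \<bullet> d l \<le> (x - f) \<bullet> d k" using x assms inc unfolding k_def
      by (intro sector_dominant(1)) auto
    moreover have "(x - f) \<bullet> d k \<le> (x - f) \<bullet> d l" using x assms inc unfolding l_def
      by (intro sector_dominant(1)) auto
    ultimately show "x \<in> {x. (d k - d l) \<bullet> x = (d k - d l) \<bullet> f}"
      by (simp add: inner_diff_left inner_diff_right inner_commute)
  qed
  moreover have "negligible {x. (d k - d l) \<bullet> x = (d k - d l) \<bullet> f}"
    using \<open>d k \<noteq> d l\<close> by (intro negligible_hyperplane) simp
  ultimately show ?thesis by (rule negligible_subset [rotated])
qed

lemma measure_sector: "measure lebesgue (sector i) = \<bar>cross2 (q i - f) (q (Suc i mod N) - f)\<bar> / 2"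
proof -
  have "measure lebesgue (sector i) = measure lborel (sector i)"
    using compact_sector by (intro measure_completion) (simp add: borel_compact)
  thus ?thesis unfolding sector_def content_triangle
    by (simp add: cross2_def abs_minus_commute mult.commute)
qed

lemma polygon_area_eq:
  "polygon_area N q = (\<Sum>i<N. \<bar>cross2 (q i - f) (q (Suc i mod N) - f)\<bar>) / 2"
proof -
  have "negligible (frontier region)" using convex_region by (rule negligible_convex_frontier)
  hence "measure lebesgue (interior region) = measure lebesgue region"
    using compact_region by (intro measure_interior compact_imp_bounded)
  also have "\<dots> = (\<Sum>i<N. measure lebesgue (sector i))"
    unfolding region_eq_sectors
    using compact_sector negligible_sector_Int
    by (intro measure_negligible_finite_Union_image) (auto simp: pairwise_def lmeasurable_compact)
  finally show ?thesis
    by (simp add: polygon_area_def polygon_interior_eq measure_sector sum_divide_distrib)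
qed

lemma sideline_eq:
  assumes "i < N"
  shows "sideline N q i = {x. (x - f) \<bullet> d (Suc i mod N) = 1}"
proof -
  note inc = incidences[OF assms]
  have "q i \<noteq> q (Suc i mod N)" using inc by auto
  thus ?thesis unfolding sideline_def using inc by (intro affine_hull_eq_hyperplane) auto
qed

lemma infdist_sideline:
  assumes "i < N"
  shows "infdist f (sideline N q i) = 1 / norm (d (Suc i mod N))"
  unfolding sideline_eq[OF assms]
  by (intro infdist_hyperplane d_nonzero incidences(1)[OF assms])

text \<open>Base times height is twice the area of the sector, and the height from \<open>f\<close>
  is the reciprocal of the norm of the edge normal.\<close>

lemma side_length_eq:
  assumes "i < N"
  shows "side_length N q i = \<bar>cross2 (q i - f) (q (Suc i mod N) - f)\<bar> * norm (d (Suc i mod N))"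
proof -
  define k where "k = Suc i mod N"
  note inc = incidences[OF assms, folded k_def]
  have "norm (q k - q i) = \<bar>cross2 (q i - f) (q k - q i)\<bar> * norm (d k)"
    using inc by (intro norm_of_orthogonal) (simp_all add: inner_diff_left)
  thus ?thesis
    using cross2_diff_self[of "q i - f" "q k - f"]
    by (simp add: side_length_def dist_norm norm_minus_commute flip: k_def)
qed

end

subsection \<open>Polar images of affinely regular polygons\<close>

lemma inner_orthonormal:
  fixes u v :: "'a::real_inner"
  assumes "norm u = 1" "norm v = 1" "u \<bullet> v = 0"
  shows "(x *\<^sub>R u + y *\<^sub>R v) \<bullet> (x' *\<^sub>R u + y' *\<^sub>R v) = x * x' + y * y'"
  using assms by (simp add: inner_add_left inner_add_right inner_commute[of v u] norm_eq_1)

lemma norm_orthonormal: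
  fixes u v :: "'a::real_inner"
  assumes "norm u = 1" "norm v = 1" "u \<bullet> v = 0"
  shows "(norm (x *\<^sub>R u + y *\<^sub>R v))\<^sup>2 = x\<^sup>2 + y\<^sup>2"
  unfolding power2_norm_eq_inner inner_orthonormal[OF assms] by (simp add: power2_eq_square)

text \<open>Absolute values appear because the frame may have either orientation:
  \<open>cross2 u v\<close> is 1 or -1.\<close>

lemma cross2_orthonormal:
  assumes "norm u = 1" "norm v = 1" "u \<bullet> v = 0"
  shows "\<bar>cross2 (x *\<^sub>R u + y *\<^sub>R v) (x' *\<^sub>R u + y' *\<^sub>R v)\<bar> = \<bar>x * y' - y * x'\<bar>"
proof -
  have u: "u $ 1 * u $ 1 + u $ 2 * u $ 2 = 1" and v: "v $ 1 * v $ 1 + v $ 2 * v $ 2 = 1"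
    and uv: "u $ 1 * v $ 1 + u $ 2 * v $ 2 = 0"
    using assms by (simp_all add: norm_eq_1 inner_real2)
  have "(cross2 u v)\<^sup>2 = 1"
    using u v uv unfolding cross2_def by algebra
  hence "\<bar>cross2 u v\<bar> = 1" by (simp add: power2_eq_1_iff abs_if) auto
  moreover have "cross2 (x *\<^sub>R u + y *\<^sub>R v) (x' *\<^sub>R u + y' *\<^sub>R v) = (x * y' - y * x') * cross2 u v"
    by (simp add: cross2_def algebra_simps)
  ultimately show ?thesis by (simp add: abs_mult)
qed

lemma orthonormal_expansion:
  fixes u v x :: "real^2"
  assumes "norm u = 1" "norm v = 1" "u \<bullet> v = 0"
  shows "x = (x \<bullet> u) *\<^sub>R u + (x \<bullet> v) *\<^sub>R v"
proof -
  have u: "u $ 1 * u $ 1 + u $ 2 * u $ 2 = 1" and v: "v $ 1 * v $ 1 + v $ 2 * v $ 2 = 1"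
    and uv: "u $ 1 * v $ 1 + u $ 2 * v $ 2 = 0"
    using assms by (simp_all add: norm_eq_1 inner_real2)
  have "x $ 1 = (x $ 1 * u $ 1 + x $ 2 * u $ 2) * u $ 1 + (x $ 1 * v $ 1 + x $ 2 * v $ 2) * v $ 1"
    "x $ 2 = (x $ 1 * u $ 1 + x $ 2 * u $ 2) * u $ 2 + (x $ 1 * v $ 1 + x $ 2 * v $ 2) * v $ 2"
    using u v uv by algebra+
  thus ?thesis by (simp add: real2_eq_iff inner_real2)
qed

text \<open>Cosine decreases on the interval from 0 to \<open>pi\<close>; a multiple with
  \<open>k > N\<close> is first reflected to \<open>2 * N - k\<close>, which is again at least
  3.\<close>

lemma cos_multiple_less:
  assumes "3 \<le> k" "k + 3 \<le> 2 * N"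
  shows "cos (real k * (pi / real N)) < cos (pi / real N)"
proof -
  have N: "N > 0" using assms by simp
  show ?thesis
  proof (cases "k \<le> N")
    case True
    have "pi / real N * 1 < pi / real N * real k" using assms N by (intro mult_strict_left_mono) auto
    moreover have "real k * (pi / real N) \<le> pi" using True N by (simp add: field_simps)
    ultimately show ?thesis by (intro cos_monotone_0_pi) (auto simp: mult.commute)
  next
    case False
    define j where "j = 2 * N - k"
    have "pi / real N * 1 < pi / real N * real j"
      using assms N by (intro mult_strict_left_mono) (auto simp: j_def)
    moreover have "real j * (pi / real N) \<le> pi"
      using False N by (simp add: field_simps j_def)
    ultimately have "cos (real j * (pi / real N)) < cos (pi / real N)"
      by (intro cos_monotone_0_pi) (auto simp: mult.commute)
    moreover have "real k * (pi / real N) = 2 * pi - real j * (pi / real N)"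
      using assms N by (simp add: j_def of_nat_diff field_simps)
    ultimately show ?thesis by (simp add: cos_diff)
  qed
qed

text \<open>Vertex directions are even multiples of \<^term>\<open>pi / N\<close>, edge normals are odd ones.\<close>
lemma cos_vertex_normal:
  fixes i j N :: nat
  assumes "3 \<le> N" "i < N" "j < N"
  defines "x \<equiv> (2 * real j + 1) * (pi / N) - 2 * real i * (pi / N)"
  shows "cos x \<le> cos (pi / N)" "cos x = cos (pi / N) \<longleftrightarrow> i = j \<or> i = Suc j mod N"
proof -
  \<comment> \<open>The angle is \<open>m\<close> times \<open>pi / N\<close> with \<open>m\<close>
    odd. Incidence means \<open>m = 1\<close>, \<open>m = -1\<close> or, for vertex 0 and the last
    normal, \<open>m = 2 * int N - 1\<close>; parity and the index range then leave absolute values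
    from 3 to \<open>2 * N - 3\<close>.\<close>
  define m where "m = 2 * int j + 1 - 2 * int i"
  define k where "k = nat \<bar>m\<bar>"
  have "x = real_of_int m * (pi / N)" by (simp add: x_def m_def algebra_simps)
  moreover have "real k = \<bar>real_of_int m\<bar>" by (simp add: k_def)
  ultimately have x: "cos x = cos (real k * (pi / N))" by (simp add: abs_if)
  have S: "Suc j mod N = (if Suc j = N then 0 else Suc j)" using assms by (simp add: mod_Suc)
  have "odd m" by (simp add: m_def)
  hence "odd k" by (auto simp: k_def even_nat_iff)
  have "cos x \<le> cos (pi / N) \<and> (cos x = cos (pi / N) \<longleftrightarrow> i = j \<or> i = Suc j mod N)"
  proof (cases "i = j \<or> i = Suc j mod N")
    case True
    then consider "m = 1" | "m = -1" | "m = 2 * int N - 1"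
      using S assms by (auto simp: m_def split: if_splits)
    hence "cos x = cos (pi / N)"
    proof cases
      case 3
      hence "x = 2 * pi - pi / N"
        using assms(1) unfolding \<open>x = real_of_int m * (pi / N)\<close>
          by (simp add: left_diff_distrib diff_divide_distrib)
      thus ?thesis by (simp add: cos_diff)
    qed (simp_all add: x k_def)
    with True show ?thesis by simp
  next
    case False
    have "m \<noteq> 1" "m \<noteq> -1" "m \<noteq> 2 * int N - 1" using False S assms by (auto simp: m_def split: if_splits)
    moreover have "- 2 * int N + 3 \<le> m" "m \<le> 2 * int N - 1" using assms by (auto simp: m_def)
    ultimately have "3 \<le> \<bar>m\<bar>" "\<bar>m\<bar> + 3 \<le> 2 * int N" using \<open>odd m\<close> by presburger+
    hence "3 \<le> k" "k + 3 \<le> 2 * N" unfolding k_def by linarith+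
    hence "cos x < cos (pi / N)" unfolding x by (rule cos_multiple_less)
    with False show ?thesis by simp
  qed
  thus "cos x \<le> cos (pi / N)" "cos x = cos (pi / N) \<longleftrightarrow> i = j \<or> i = Suc j mod N" by auto
qed

text \<open>Wrapping the index from \<open>N\<close> to 0 changes the angle by a full turn. The
  shift \<open>h\<close> is 0 for vertices and 1 for contact points.\<close>

lemma cos_sin_Suc_mod:
  fixes i N :: nat and t :: real
  assumes "i < N"
  shows "cos (t + (2 * real (Suc i mod N) + h) * (pi / N)) = cos (t + (2 * real (Suc i) + h) * (pi / N))"
    "sin (t + (2 * real (Suc i mod N) + h) * (pi / N)) = sin (t + (2 * real (Suc i) + h) * (pi / N))"
proof -
  consider "Suc i mod N = Suc i" | "Suc i = N" "Suc i mod N = 0" using assms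
    by (cases "Suc i = N") auto
  moreover have "t + (2 * real N + h) * (pi / N) = (t + h * (pi / N)) + 2 * pi"
    using assms by (simp add: field_simps)
  ultimately have "cos (t + (2 * real (Suc i mod N) + h) * (pi / N)) = cos (t + (2 * real (Suc i) + h) * (pi / N)) \<and>
    sin (t + (2 * real (Suc i mod N) + h) * (pi / N)) = sin (t + (2 * real (Suc i) + h) * (pi / N))"
    by cases (simp_all only: sin_periodic cos_periodic mult_zero_right of_nat_0 add_0_left simp_thms)
  thus "cos (t + (2 * real (Suc i mod N) + h) * (pi / N)) = cos (t + (2 * real (Suc i) + h) * (pi / N))"
    "sin (t + (2 * real (Suc i mod N) + h) * (pi / N)) = sin (t + (2 * real (Suc i) + h) * (pi / N))"
    by auto
qed

text \<open>The vectors \<open>d i\<close> from \<open>f\<close> to the original vertices are the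
  edge normals of the polar image and the explicit poles \<open>Q i\<close> are its vertices, so
  \<open>polar_polygon\<close> applies. Either sign of \<kappa> is allowed, which covers both
  foci.\<close>

lemma polar_image_of_regular:
  fixes u v c f :: "real^2" and a b \<kappa> t r :: real and N :: nat and p :: "nat \<Rightarrow> real^2"
  assumes on: "norm u = 1" "norm v = 1" "u \<bullet> v = 0"
    and ab: "a > 0" "b > 0" and \<kappa>: "\<kappa>\<^sup>2 = a\<^sup>2 - b\<^sup>2" and N: "3 \<le> N"
    and r: "r = cos (pi / N)" and f: "f = c + (r * \<kappa>) *\<^sub>R u"
    and p: "\<forall>i<N. p i = c + (a * cos (t + 2 * real i * (pi / N))) *\<^sub>R u
                                 + (b * sin (t + 2 * real i * (pi / N))) *\<^sub>R v"
  defines "D \<equiv> \<lambda>i. a - \<kappa> * cos (t + (2 * real i + 1) * (pi / N))"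
  shows "harmonic_polygon N (polar_image N f 1 p)"
    and "polygon_area N (polar_image N f 1 p) =
           a * sin (2 * pi / N) / (2 * r\<^sup>2 * b) * (\<Sum>i<N. 1 / (D i * D (Suc i)))"
    and "\<And>i. D i > 0"
proof -
  define \<phi> \<theta> where "\<phi> = (\<lambda>i::nat. t + (2 * real i + 1) * (pi / N))"
    and "\<theta> = (\<lambda>i::nat. t + 2 * real i * (pi / N))"
  \<comment> \<open>In centred coordinates the tangent at \<phi> is
    \<open>x * cos \<phi> / (r * a) + y * sin \<phi> / (r * b) = 1\<close>. Moving the origin to
    \<open>f\<close> changes the right side to \<open>D i / a\<close>; dividing by it gives the
    coefficients of \<open>Q i\<close>.\<close>
  define d Q where "d = (\<lambda>i. (a * cos (\<theta> i) - r * \<kappa>) *\<^sub>R u + (b * sin (\<theta> i)) *\<^sub>R v)"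
    and "Q = (\<lambda>i. f + ((cos (\<phi> i) / (r * D i)) *\<^sub>R u + (a * sin (\<phi> i) / (r * b * D i)) *\<^sub>R v))"
  define s where "s = sin (pi / N)"
  note inner_uv = inner_orthonormal[OF on] and norm_uv = norm_orthonormal[OF on]
  have "pi / N \<le> pi / 3" using N by (intro divide_left_mono) auto
  moreover have "pi / N > 0" using N by simp
  ultimately have "0 < pi / N" "pi / N < pi / 2" "pi / N < pi" using pi_gt_zero by linarith+
  hence r0: "r > 0" and s0: "s > 0" unfolding r s_def by (auto intro!: cos_gt_zero sin_gt_zero_02 sin_gt_zero)
  have rs: "r\<^sup>2 + s\<^sup>2 = 1" by (simp add: r s_def)
  have "\<kappa>\<^sup>2 < a\<^sup>2" using \<kappa> ab by simp
  hence "\<bar>\<kappa>\<bar> < a" using ab abs_le_square_iff[of a \<kappa>] by (auto simp: not_le)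
  hence D0: "D i > 0" for i
  proof -
    have "\<bar>\<kappa> * cos (\<phi> i)\<bar> \<le> \<bar>\<kappa>\<bar> * 1" unfolding abs_mult by (intro mult_left_mono) auto
    with \<open>\<bar>\<kappa>\<bar> < a\<close> show ?thesis unfolding D_def \<phi>_def by linarith
  qed
  thus "\<And>i. D i > 0" .
  have D: "D i = a - \<kappa> * cos (\<phi> i)" for i by (simp add: D_def \<phi>_def)
  have pd: "p i - f = d i" if "i < N" for i
    using p[rule_format, OF that] unfolding f d_def \<theta>_def by (simp add: algebra_simps)
  \<comment> \<open>The deviation from 1 has the sign of
    \<open>cos (\<phi> j - \<theta> i) - r\<close>, which reduces both locale assumptions to
    \<open>cos_vertex_normal\<close>.\<close>
  have inner_Qd: "(Q j - f) \<bullet> d i = 1 + a * (cos (\<phi> j - \<theta> i) - r) / (r * D j)" for i j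
  proof -
    have "(Q j - f) \<bullet> d i = cos (\<phi> j) / (r * D j) * (a * cos (\<theta> i) - r * \<kappa>)
        + a * sin (\<phi> j) / (r * b * D j) * (b * sin (\<theta> i))"
      unfolding Q_def d_def add_diff_cancel_left' inner_uv ..
    also have "\<dots> = (a * cos (\<phi> j - \<theta> i) - r * (\<kappa> * cos (\<phi> j))) / (r * D j)"
      using r0 ab D0[of j] by (simp add: cos_diff divide_simps) (simp add: algebra_simps)
    also have "\<kappa> * cos (\<phi> j) = a - D j" by (simp add: D)
    finally show ?thesis using r0 D0[of j] by (simp add: divide_simps) (simp add: algebra_simps)
  qed
  have cosle: "cos (\<phi> j - \<theta> i) \<le> r" "cos (\<phi> j - \<theta> i) = r \<longleftrightarrow> i = j \<or> i = Suc j mod N"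
    if "i < N" "j < N" for i j
    using cos_vertex_normal[OF N that] unfolding r \<phi>_def \<theta>_def by simp_all
  have PQ: "polar_polygon N f Q d"
  proof
    fix i j assume ij: "i < N" "j < N"
    have pos: "a / (r * D j) > 0" using ab r0 D0 by simp
    have e: "(Q j - f) \<bullet> d i = 1 + (a / (r * D j)) * (cos (\<phi> j - \<theta> i) - r)"
      unfolding inner_Qd by simp
    show "(Q j - f) \<bullet> d i \<le> 1"
      unfolding e using mult_nonneg_nonpos[OF less_imp_le[OF pos]] cosle(1)[OF ij] by simp
    show "(Q j - f) \<bullet> d i = 1 \<longleftrightarrow> i = j \<or> i = Suc j mod N"
      unfolding e using pos cosle(2)[OF ij] by auto
  qed (rule N)
  interpret Q: polar_polygon N f Q d by (rule PQ)
  have Q: "polar_image N f 1 p i = Q i" if i: "i < N" for i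
  proof -
    note inc = Q.incidences[OF i]
    have "(p i - f) \<bullet> (Q i - f) = 1" "(p (Suc i mod N) - f) \<bullet> (Q i - f) = 1"
      using inc by (simp_all add: pd i inner_commute)
    moreover have "p i \<noteq> p (Suc i mod N)"
      using inc pd[OF i] pd[OF inc(1)] by auto
    ultimately show ?thesis unfolding polar_image_def sideline_def by (rule pole_line)
  qed
  have Suc_lt: "Suc i mod N < N" for i using N by simp
  \<comment> \<open>The locale is interpreted again for \<open>polar_image\<close> itself, which has
    been identified with \<open>Q\<close> at indices below \<open>N\<close>.\<close>
  interpret R: polar_polygon N f "polar_image N f 1 p" d
    by standard (use N Q.le1 Q.eq1 in \<open>simp_all add: Q\<close>)
  define K where "K = a * sin (2 * pi / N) / (r\<^sup>2 * b)"
  have sin2: "sin (2 * pi / N) = 2 * s * r" using sin_double[of "pi / N"] by (simp add: s_def r)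
  hence K0: "K > 0" unfolding K_def using ab r0 s0 by simp
  have D_Suc: "D (Suc i mod N) = D (Suc i)" if "i < N" for i
    unfolding D_def using that by (simp only: cos_sin_Suc_mod)
  have cross: "\<bar>cross2 (polar_image N f 1 p i - f) (polar_image N f 1 p (Suc i mod N) - f)\<bar>
      = K / (D i * D (Suc i))" if i: "i < N" for i
  proof -
    have "\<phi> (Suc i) - \<phi> i = 2 * pi / N" by (simp add: \<phi>_def add_divide_distrib distrib_right)
    hence sin_diff: "sin (2 * pi / N) = cos (\<phi> i) * sin (\<phi> (Suc i)) - sin (\<phi> i) * cos (\<phi> (Suc i))"
      by (metis sin_diff mult.commute)
    have cs: "cos (\<phi> (Suc i mod N)) = cos (\<phi> (Suc i))" "sin (\<phi> (Suc i mod N)) = sin (\<phi> (Suc i))"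
      unfolding \<phi>_def using i by (simp_all only: cos_sin_Suc_mod)
    moreover have "cos (\<phi> i) / (r * D i) * (a * sin (\<phi> (Suc i mod N)) / (r * b * D (Suc i mod N)))
        - a * sin (\<phi> i) / (r * b * D i) * (cos (\<phi> (Suc i mod N)) / (r * D (Suc i mod N)))
        = K / (D i * D (Suc i))"
      using r0 ab D0 unfolding K_def sin_diff cs D_Suc[OF i]
      by (simp add: divide_simps less_imp_neq[symmetric]) (simp add: power2_eq_square algebra_simps)
    moreover have "K / (D i * D (Suc i)) > 0" using K0 D0 by simp
    ultimately show ?thesis
      unfolding Q[OF i] Q[OF Suc_lt] unfolding Q_def add_diff_cancel_left' cross2_orthonormal[OF on]
      by (simp only: abs_of_pos)
  qed
  have norm_d: "(norm (d (Suc i mod N)))\<^sup>2 = D i * D (Suc i)" if i: "i < N" for i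
  proof -
    define C S where "C = cos (\<theta> (Suc i))" and "S = sin (\<theta> (Suc i))"
    \<comment> \<open>The vertex angle lies midway between the two contact angles, so both factors
      expand in \<open>C\<close> and \<open>S\<close> and the claim becomes polynomial.\<close>
    have "\<phi> i = \<theta> (Suc i) - pi / N" "\<phi> (Suc i) = \<theta> (Suc i) + pi / N"
      by (simp_all add: \<phi>_def \<theta>_def distrib_left distrib_right add_divide_distrib)
    hence c: "cos (\<phi> i) = C * r + S * s" "cos (\<phi> (Suc i)) = C * r - S * s"
      by (simp_all add: cos_add cos_diff r s_def C_def S_def)
    have cs: "cos (\<theta> (Suc i mod N)) = C" "sin (\<theta> (Suc i mod N)) = S"
      unfolding \<theta>_def C_def S_def using cos_sin_Suc_mod[OF i, of t 0] by (simp_all add: algebra_simps)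
    have "C\<^sup>2 + S\<^sup>2 = 1" by (simp add: C_def S_def)
    hence "(a * C - r * \<kappa>)\<^sup>2 + (b * S)\<^sup>2 = (a - \<kappa> * (C * r + S * s)) * (a - \<kappa> * (C * r - S * s))"
      using \<kappa> rs by algebra
    thus ?thesis unfolding d_def norm_uv cs D c .
  qed
  have norm_d0: "norm (d (Suc i mod N)) > 0" for i using R.d_nonzero[OF Suc_lt] by simp
  have "side_length N (polar_image N f 1 p) i = K / norm (d (Suc i mod N))" if i: "i < N" for i
    unfolding R.side_length_eq[OF i] cross[OF i] norm_d[OF i, symmetric]
    using norm_d0[of i] by (simp add: power2_eq_square)
  hence "\<forall>i<N. infdist f (sideline N (polar_image N f 1 p) i) = 1 / K * side_length N (polar_image N f 1 p) i"
    using K0 by (simp add: R.infdist_sideline)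
  \<comment> \<open>The circle is the inverse, in the unit circle about \<open>f\<close>, of the
    pedal circle of the inner ellipse. With semiaxes \<open>r * a\<close>, \<open>r * b\<close> and
    focal distance \<open>r * \<kappa>\<close> its centre is offset by
    \<open>r * \<kappa> / (r * b)\<^sup>2\<close> and its radius is
    \<open>r * a / (r * b)\<^sup>2\<close>.\<close>
  moreover have "polar_image N f 1 p i \<in> sphere (f + (\<kappa> / (r * b\<^sup>2)) *\<^sub>R u) (a / (r * b\<^sup>2))" if i: "i < N" for i
  proof -
    have "Q i - (f + (\<kappa> / (r * b\<^sup>2)) *\<^sub>R u)
        = (cos (\<phi> i) / (r * D i) - \<kappa> / (r * b\<^sup>2)) *\<^sub>R u + (a * sin (\<phi> i) / (r * b * D i)) *\<^sub>R v"
      unfolding Q_def by (simp add: algebra_simps)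
    hence "(dist (Q i) (f + (\<kappa> / (r * b\<^sup>2)) *\<^sub>R u))\<^sup>2
        = (cos (\<phi> i) / (r * D i) - \<kappa> / (r * b\<^sup>2))\<^sup>2 + (a * sin (\<phi> i) / (r * b * D i))\<^sup>2"
      unfolding dist_norm by (simp only: norm_uv)
    also have "\<dots> = ((b\<^sup>2 * cos (\<phi> i) - \<kappa> * D i)\<^sup>2 + (a * b * sin (\<phi> i))\<^sup>2) / (r * b\<^sup>2 * D i)\<^sup>2"
    proof -
      have "cos (\<phi> i) / (r * D i) - \<kappa> / (r * b\<^sup>2) = (b\<^sup>2 * cos (\<phi> i) - \<kappa> * D i) / (r * b\<^sup>2 * D i)"
        "a * sin (\<phi> i) / (r * b * D i) = a * b * sin (\<phi> i) / (r * b\<^sup>2 * D i)"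
        using r0 ab D0[of i] by (simp_all add: field_simps power2_eq_square)
      thus ?thesis by (simp only: power_divide add_divide_distrib)
    qed
    also have "(b\<^sup>2 * cos (\<phi> i) - \<kappa> * D i)\<^sup>2 + (a * b * sin (\<phi> i))\<^sup>2 = (a * D i)\<^sup>2"
      using \<kappa> sin_cos_squared_add[of "\<phi> i"] unfolding D by algebra
    also have "(a * D i)\<^sup>2 / (r * b\<^sup>2 * D i)\<^sup>2 = (a / (r * b\<^sup>2))\<^sup>2"
      using D0[of i] by (simp add: power_divide power_mult_distrib)
    finally have "dist (Q i) (f + (\<kappa> / (r * b\<^sup>2)) *\<^sub>R u) = a / (r * b\<^sup>2)"
      using ab r0 by (elim power2_eq_imp_eq) simp_all
    thus ?thesis by (simp add: Q i dist_commute)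
  qed
  moreover have "a / (r * b\<^sup>2) > 0" using ab r0 by simp
  ultimately show "harmonic_polygon N (polar_image N f 1 p)"
    unfolding harmonic_polygon_def using R.f_in_polygon_interior by (intro conjI exI bexI allI impI) blast+
  show "polygon_area N (polar_image N f 1 p) =
           a * sin (2 * pi / N) / (2 * r\<^sup>2 * b) * (\<Sum>i<N. 1 / (D i * D (Suc i)))"
    unfolding R.polygon_area_eq by (simp add: cross K_def sum_distrib_left sum_divide_distrib ac_simps)
qed

subsection \<open>Polygons interscribed between homothetic ellipses\<close>

definition ellipse_point :: "real^2 \<Rightarrow> real^2 \<Rightarrow> real^2 \<Rightarrow> real \<Rightarrow> real \<Rightarrow> real \<Rightarrow> real^2" where
  "ellipse_point c u v a b t = c + ((a * cos t) *\<^sub>R u + (b * sin t) *\<^sub>R v)"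

lemma ellipse_pointE:
  assumes on: "norm u = 1" "norm v = 1" "u \<bullet> v = 0" and "a > 0" "b > 0" and x: "x \<in> ellipse c u v a b"
  obtains t where "x = ellipse_point c u v a b t"
proof -
  have "((x - c) \<bullet> u / a)\<^sup>2 + ((x - c) \<bullet> v / b)\<^sup>2 = 1" using x by (simp add: ellipse_def)
  then obtain t where t: "(x - c) \<bullet> u / a = cos t" "(x - c) \<bullet> v / b = sin t"
    by (rule sincos_total_2pi)
  hence uv: "(x - c) \<bullet> u = a * cos t" "(x - c) \<bullet> v = b * sin t" using assms by (simp_all add: field_simps)
  have "x = c + (x - c)" by simp
  also have "x - c = (a * cos t) *\<^sub>R u + (b * sin t) *\<^sub>R v"
    using orthonormal_expansion[OF on, of "x - c"] unfolding uv .
  finally show ?thesis by (intro that[of t]) (simp add: ellipse_point_def)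
qed

text \<open>Scaling the axes by \<open>1 / a\<close> and \<open>1 / b\<close> turns the ellipses
  into circles of radii 1 and \<open>r\<close>; the squared norm of a point of the chord then
  depends on \<open>l\<close> only through \<open>l * (1 - l)\<close>.\<close>

lemma chord_in_ellipse_iff:
  fixes l :: real
  assumes on: "norm u = 1" "norm v = 1" "u \<bullet> v = 0" and "a > 0" "b > 0" "r > 0"
  shows "(1 - l) *\<^sub>R ellipse_point c u v a b s + l *\<^sub>R ellipse_point c u v a b t \<in> ellipse c u v (r * a) (r * b)
    \<longleftrightarrow> 1 - 2 * (1 - cos (s - t)) * (l * (1 - l)) = r\<^sup>2"
proof -
  let ?x = "(1 - l) *\<^sub>R ellipse_point c u v a b s + l *\<^sub>R ellipse_point c u v a b t"
  let ?X = "(1 - l) * cos s + l * cos t" and ?Y = "(1 - l) * sin s + l * sin t"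
  have x: "?x - c = (a * ?X) *\<^sub>R u + (b * ?Y) *\<^sub>R v"
    by (simp add: ellipse_point_def algebra_simps)
  have "(?x - c) \<bullet> u / (r * a) = ?X / r" "(?x - c) \<bullet> v / (r * b) = ?Y / r"
    unfolding x using inner_orthonormal[OF on, of "a * ?X" "b * ?Y" 1 0]
      inner_orthonormal[OF on, of "a * ?X" "b * ?Y" 0 1] assms by simp_all
  hence "?x \<in> ellipse c u v (r * a) (r * b) \<longleftrightarrow> (?X / r)\<^sup>2 + (?Y / r)\<^sup>2 = 1"
    unfolding ellipse_def by simp
  also have "\<dots> \<longleftrightarrow> ?X\<^sup>2 + ?Y\<^sup>2 = r\<^sup>2"
    using assms(6) by (simp add: power_divide flip: add_divide_distrib) (rule eq_commute)
  also have "?X\<^sup>2 + ?Y\<^sup>2 = 1 - 2 * (1 - cos (s - t)) * (l * (1 - l))"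
    using sin_cos_squared_add[of s] sin_cos_squared_add[of t] unfolding cos_diff by algebra
  finally show ?thesis .
qed

text \<open>The intersection with the inner ellipse is symmetric about the midpoint of the chord, so a
  tangent chord touches it there.\<close>
lemma cos_diff_of_tangent_chord:
  assumes on: "norm u = 1" "norm v = 1" "u \<bullet> v = 0" and "a > 0" "b > 0" "r > 0"
    and ne: "ellipse_point c u v a b s \<noteq> ellipse_point c u v a b t"
    and tan: "line_tangent (affine hull {ellipse_point c u v a b s, ellipse_point c u v a b t})
                (ellipse c u v (r * a) (r * b))"
  shows "cos (s - t) = 2 * r\<^sup>2 - 1"
proof -
  let ?L = "affine hull {ellipse_point c u v a b s, ellipse_point c u v a b t}"
  let ?E = "ellipse c u v (r * a) (r * b)"
  define x where "x = (\<lambda>l. (1 - l) *\<^sub>R ellipse_point c u v a b s + l *\<^sub>R ellipse_point c u v a b t)"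
  have E: "x l \<in> ?E \<longleftrightarrow> 1 - 2 * (1 - cos (s - t)) * (l * (1 - l)) = r\<^sup>2" for l
    unfolding x_def by (rule chord_in_ellipse_iff) (use assms in auto)
  have L: "?L = range x"
  proof (intro equalityI subsetI)
    fix y assume "y \<in> ?L"
    then obtain l k where "l + k = 1"
      and y: "y = l *\<^sub>R ellipse_point c u v a b s + k *\<^sub>R ellipse_point c u v a b t"
      unfolding affine_hull_2 by blast
    hence "l = 1 - k" by simp
    thus "y \<in> range x" unfolding y x_def by blast
  next
    fix y assume "y \<in> range x"
    then obtain k where "y = (1 - k) *\<^sub>R ellipse_point c u v a b s + k *\<^sub>R ellipse_point c u v a b t"
      unfolding x_def by blast
    thus "y \<in> ?L" unfolding affine_hull_2 by (intro CollectI exI[of _ "1 - k"] exI[of _ k]) simp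
  qed
  obtain y where y': "y \<in> ?L \<inter> ?E" and uniq': "\<forall>z. z \<in> ?L \<inter> ?E \<longrightarrow> z = y"
    using tan unfolding line_tangent_def by (rule ex1E)
  note y = IntD1[OF y'] IntD2[OF y'] and uniq = uniq'[rule_format, OF IntI]
  obtain l where yl: "y = x l" using y(1) unfolding L by (rule rangeE)
  have "x (1 - l) \<in> ?L" unfolding L by simp
  moreover have "x (1 - l) \<in> ?E" using y(2) unfolding yl E by (simp add: mult.commute)
  ultimately have "x (1 - l) = x l" unfolding yl[symmetric] by (rule uniq)
  moreover have "x l - x (1 - l) = (1 - l - l) *\<^sub>R (ellipse_point c u v a b s - ellipse_point c u v a b t)"
    unfolding x_def vec_eq_iff by (simp add: algebra_simps)
  ultimately have "1 - l - l = 0" using ne by simp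
  hence "l = 1 / 2" by simp
  from y(2) show ?thesis unfolding yl E \<open>l = 1 / 2\<close> by (simp add: field_simps)
qed

lemma ellipse_point_eq_of_cos_diff:
  assumes "cos (s - t) = cos \<beta>" "e = 1 \<or> e = -1"
  shows "ellipse_point c u v a b t = ellipse_point c u v a b (s + e * \<beta>)
    \<or> ellipse_point c u v a b t = ellipse_point c u v a b (s - e * \<beta>)"
proof -
  have "cos (t - s) = cos \<beta>" using assms(1) cos_minus[of "s - t"] by simp
  then obtain n where "n \<in> \<int>" and n: "t - s = \<beta> + 2 * n * pi \<or> t - s = - \<beta> + 2 * n * pi"
    unfolding cos_eq by blast
  then obtain k where "n = of_int k" by (auto elim: Ints_cases)
  hence k: "t = (s + \<beta>) + 2 * pi * of_int k \<or> t = (s - \<beta>) + 2 * pi * of_int k"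
    using n by (auto simp: algebra_simps)
  have per: "cos (x + 2 * pi * of_int k) = cos x" "sin (x + 2 * pi * of_int k) = sin x" for x
    by (simp_all add: cos_add sin_add sin_int_2pin cos_int_2pin)
  show ?thesis using k assms(2) by (auto simp: ellipse_point_def per simp del: cos_periodic)
qed

lemma ellipse_point_eqD:
  assumes on: "norm u = 1" "norm v = 1" "u \<bullet> v = 0" and "a > 0" "b > 0"
    and "ellipse_point c u v a b s = ellipse_point c u v a b t"
  shows "cos (s - t) = 1"
proof -
  have "(a * cos s) *\<^sub>R u + (b * sin s) *\<^sub>R v = (a * cos t) *\<^sub>R u + (b * sin t) *\<^sub>R v"
    using assms by (simp add: ellipse_point_def)
  hence "((a * cos s) *\<^sub>R u + (b * sin s) *\<^sub>R v) \<bullet> (1 *\<^sub>R u + 0 *\<^sub>R v) = ((a * cos t) *\<^sub>R u + (b * sin t) *\<^sub>R v) \<bullet> (1 *\<^sub>R u + 0 *\<^sub>R v)"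
    "((a * cos s) *\<^sub>R u + (b * sin s) *\<^sub>R v) \<bullet> (0 *\<^sub>R u + 1 *\<^sub>R v) = ((a * cos t) *\<^sub>R u + (b * sin t) *\<^sub>R v) \<bullet> (0 *\<^sub>R u + 1 *\<^sub>R v)"
    by (simp_all only:)
  hence "cos s = cos t" "sin s = sin t"
    unfolding inner_orthonormal[OF on] using assms by simp_all
  thus ?thesis by (simp add: cos_diff flip: power2_eq_square)
qed

text \<open>Absorbs the sense of traversal into the frame by reflecting \<open>v\<close>, so that
  afterwards the angles increase.\<close>

lemma ellipse_point_minus:
  "e = 1 \<or> e = -1 \<Longrightarrow> ellipse_point c u v a b (e * t) = ellipse_point c u (e *\<^sub>R v) a b t"
  by (auto simp: ellipse_point_def)

text \<open>Here \<open>e\<close> is the sense of traversal and \<open>k\<close> the number of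
  turns. The step \<beta> satisfies \<open>cos (\<beta> / 2) = r\<close>; closing up makes
  \<open>N * \<beta>\<close> a multiple of a full turn, and \<open>\<beta> < pi\<close> bounds
  \<open>k\<close>.\<close>

lemma interscribed_homothetic_angles:
  fixes u v c :: "real^2" and p :: "nat \<Rightarrow> real^2"
  assumes on: "norm u = 1" "norm v = 1" "u \<bullet> v = 0" and ab: "a > 0" "b > 0" and r: "0 < r" "r < 1"
    and N: "3 \<le> N" and inj: "inj_on p {..<N}"
    and int: "interscribed N p (ellipse c u v a b) (ellipse c u v (r * a) (r * b))"
  obtains e t :: real and k :: nat where "e = 1 \<or> e = -1" "0 < k" "2 * k < N" "r = cos (k * pi / N)"
    "\<And>i. i < N \<Longrightarrow> p i = ellipse_point c u (e *\<^sub>R v) a b (t + i * (2 * k * pi / N))"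
proof -
  let ?E = "ellipse_point c u v a b"
  define \<beta> where "\<beta> = 2 * arccos r"
  have "0 < arccos r" "arccos r < pi / 2"
    using r arccos_lt_bounded[of r] arccos_less_arccos[of 0 r] by (auto simp: arccos_0)
  hence \<beta>: "0 < \<beta>" "\<beta> < pi" by (auto simp: \<beta>_def)
  have cos\<beta>: "cos \<beta> = 2 * r\<^sup>2 - 1" unfolding \<beta>_def cos_double_cos using r by simp
  have dist: "p i \<noteq> p j" if "i < N" "j < N" "i \<noteq> j" for i j
    using inj that by (auto simp: inj_on_def)
  have next_vertex: "p (Suc i mod N) = ?E (s + e * \<beta>) \<or> p (Suc i mod N) = ?E (s - e * \<beta>)"
    if i: "i < N" and s: "p i = ?E s" and e: "e = 1 \<or> e = -1" for i s e
  proof -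
    have k: "Suc i mod N < N" using N by simp
    hence "p (Suc i mod N) \<in> ellipse c u v a b" using int by (auto simp: interscribed_def)
    then obtain t where t: "p (Suc i mod N) = ?E t" using ellipse_pointE[OF on ab] by blast
    have "?E s \<noteq> ?E t" using dist[OF i k] Suc_mod_cycle(3)[OF N i] s t by simp
    moreover have "line_tangent (affine hull {?E s, ?E t}) (ellipse c u v (r * a) (r * b))"
      using int i unfolding interscribed_def sideline_def s[symmetric] t[symmetric] by blast
    ultimately have "cos (s - t) = cos \<beta>"
      unfolding cos\<beta> by (intro cos_diff_of_tangent_chord[OF on ab r(1)])
    thus ?thesis unfolding t using e by (rule ellipse_point_eq_of_cos_diff)
  qed
  have "p 0 \<in> ellipse c u v a b" using int N by (auto simp: interscribed_def)
  then obtain t where t: "p 0 = ?E t" using ellipse_pointE[OF on ab] by blast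
  have "p 1 = ?E (t + 1 * \<beta>) \<or> p 1 = ?E (t - 1 * \<beta>)"
    using next_vertex[OF _ t, of 1] N by simp
  then obtain e :: real where e: "e = 1 \<or> e = -1" and p1: "p 1 = ?E (t + e * \<beta>)"
    by (metis diff_conv_add_uminus mult_minus_left)
  \<comment> \<open>A change of direction would lead back to \<open>p i\<close>, against the
    distinctness of the vertices.\<close>
  have step: "p (Suc (Suc i) mod N) = ?E (t + e * (real (Suc (Suc i)) * \<beta>))"
    if "Suc i < N" "p i = ?E (t + e * (real i * \<beta>))" "p (Suc i) = ?E (t + e * (real (Suc i) * \<beta>))" for i
  proof -
    have "p (Suc (Suc i) mod N) \<noteq> p i"
      using Suc_mod_cycle(2,5)[OF N, of i] that(1) by (intro dist) auto
    moreover have eqs: "t + e * (real (Suc i) * \<beta>) - e * \<beta> = t + e * (real i * \<beta>)"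
      "t + e * (real (Suc i) * \<beta>) + e * \<beta> = t + e * (real (Suc (Suc i)) * \<beta>)" by (simp_all add: algebra_simps)
    have "p (Suc (Suc i) mod N) = ?E (t + e * (real (Suc (Suc i)) * \<beta>)) \<or> p (Suc (Suc i) mod N) = p i"
      using next_vertex[OF that(1,3) e] unfolding eqs that(2) .
    ultimately show ?thesis by blast
  qed
  have p: "p i = ?E (t + e * (real i * \<beta>)) \<and> (Suc i < N \<longrightarrow> p (Suc i) = ?E (t + e * (real (Suc i) * \<beta>)))"
    if "i < N" for i
    using that
  proof (induction i)
    case 0
    have "p 0 = ?E (t + e * (real 0 * \<beta>))" "p (Suc 0) = ?E (t + e * (real (Suc 0) * \<beta>))"
      using t p1 by simp_all
    thus ?case by blast
  next
    case (Suc i)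
    hence IH: "p i = ?E (t + e * (real i * \<beta>))" "p (Suc i) = ?E (t + e * (real (Suc i) * \<beta>))" by auto
    have "p (Suc (Suc i)) = ?E (t + e * (real (Suc (Suc i)) * \<beta>))" if "Suc (Suc i) < N"
      using step[OF Suc.prems IH] that by (simp only: mod_less)
    with IH show ?case by blast
  qed
  \<comment> \<open>At \<open>i = N - 2\<close> the index in \<open>step\<close> wraps around, so
    the point reached after \<open>N\<close> rotations is \<open>p 0\<close>.\<close>
  obtain m where m: "N = Suc (Suc m)" using N by (intro that[of "N - 2"]) simp
  have "p 0 = ?E (t + e * (real N * \<beta>))" using step[of m] p[of m] unfolding m by simp
  hence "cos (t + e * (real N * \<beta>) - t) = 1"
    using ellipse_point_eqD[OF on ab, of c "t + e * (real N * \<beta>)" t] t by simp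
  hence "cos (real N * \<beta>) = 1" using e by auto
  from iffD1[OF cos_one_2pi_int this] obtain n :: int where n: "real N * \<beta> = real_of_int n * 2 * pi" ..
  define k where "k = nat n"
  have "real N * \<beta> > 0" "real N * \<beta> < real N * pi" using N \<beta> by simp_all
  hence "0 < real_of_int n" "real_of_int n * 2 < real N"
    unfolding n mult_less_cancel_right_pos[OF pi_gt_zero] by (simp_all add: zero_less_mult_iff)
  hence "0 < n" "2 * n < int N" by linarith+
  hence k: "0 < k" "2 * k < N" "real_of_int n = real k" unfolding k_def by auto
  hence \<beta>k: "\<beta> = 2 * k * pi / N" using n N by (simp add: field_simps)
  have "arccos r = k * pi / N" using \<beta>k by (simp add: \<beta>_def)
  hence rk: "r = cos (k * pi / N)" using r cos_arccos[of r] by simp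
  have "p i = ellipse_point c u (e *\<^sub>R v) a b (e * t + i * (2 * k * pi / N))" if "i < N" for i
  proof -
    have "p i = ?E (e * (e * t + i * \<beta>))" using conjunct1[OF p[OF that]] e by (auto simp: distrib_left)
    thus ?thesis unfolding ellipse_point_minus[OF e] \<beta>k .
  qed
  thus ?thesis by (rule that[OF e k(1,2) rk])
qed

section \<open>Pentagon trigonometry and the pentagram\<close>

lemma cos_2pi_5: "4 * (cos (2 * pi / 5))\<^sup>2 + 2 * cos (2 * pi / 5) - 1 = 0"
  and cos_2pi_5_pos: "cos (2 * pi / 5) > 0"
  and sqrt_5_eq: "sqrt 5 = 4 * cos (2 * pi / 5) + 1"
proof -
  define x where "x = 2 * pi / 5"
  show pos: "cos (2 * pi / 5) > 0" by (intro cos_gt_zero) auto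
  \<comment> \<open>Five times \<open>x\<close> is a full turn, so \<open>3 * x\<close> and
    \<open>2 * x\<close> have the same cosine; the resulting cubic has the spurious factor
    \<open>cos x - 1\<close>.\<close>
  have "cos (3 * x) = cos (2 * pi - 2 * x)" by (rule arg_cong[of _ _ cos]) (simp add: x_def)
  also have "\<dots> = cos (2 * x)" by (simp add: cos_diff)
  finally have "4 * cos x ^ 3 - 3 * cos x = 2 * (cos x)\<^sup>2 - 1"
    unfolding cos_treble_cos cos_double_cos .
  hence "(cos x - 1) * (4 * (cos x)\<^sup>2 + 2 * cos x - 1) = 0" by algebra
  moreover have "cos x < cos 0" by (intro cos_monotone_0_pi) (auto simp: x_def)
  ultimately show *: "4 * (cos (2 * pi / 5))\<^sup>2 + 2 * cos (2 * pi / 5) - 1 = 0" by (simp add: x_def)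
  have "(4 * cos (2 * pi / 5) + 1)\<^sup>2 = 5" using * by algebra
  thus "sqrt 5 = 4 * cos (2 * pi / 5) + 1" using pos by (intro real_sqrt_unique) auto
qed

lemma cos_sin_multiples_2pi_5:
  defines "x \<equiv> cos (2 * pi / 5)" and "y \<equiv> sin (2 * pi / 5)"
  shows "cos (4 * pi / 5) = 2 * x\<^sup>2 - 1" "sin (4 * pi / 5) = 2 * y * x"
    "cos (6 * pi / 5) = 2 * x\<^sup>2 - 1" "sin (6 * pi / 5) = - (2 * y * x)"
    "cos (8 * pi / 5) = x" "sin (8 * pi / 5) = - y"
proof -
  have 4: "4 * pi / 5 = 2 * (2 * pi / 5)" by simp
  show c4: "cos (4 * pi / 5) = 2 * x\<^sup>2 - 1" and s4: "sin (4 * pi / 5) = 2 * y * x"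
    unfolding 4 cos_double_cos sin_double x_def y_def by simp_all
  have 6: "6 * pi / 5 = 2 * pi - 4 * pi / 5" and 8: "8 * pi / 5 = 2 * pi - 2 * pi / 5" by simp_all
  show "cos (6 * pi / 5) = 2 * x\<^sup>2 - 1" "sin (6 * pi / 5) = - (2 * y * x)"
    unfolding 6 cos_diff sin_diff c4 s4 by simp_all
  show "cos (8 * pi / 5) = x" "sin (8 * pi / 5) = - y"
    unfolding 8 cos_diff sin_diff by (simp_all add: x_def y_def)
qed

text \<open>In a regular pentagram the sides \<open>01\<close> and \<open>23\<close> cross, dividing each other in the golden
  ratio, so neither is an edge of the convex hull.\<close>
lemma pentagram_not_convex:
  fixes u v c :: "real^2" and p :: "nat \<Rightarrow> real^2"
  assumes on: "norm u = 1" "norm v = 1" "u \<bullet> v = 0" and ab: "a > 0" "b > 0"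
    and p: "\<And>i. i < 5 \<Longrightarrow> p i = ellipse_point c u v a b (t + real i * (2 * real 2 * pi / real 5))"
  shows "\<not> convex_polygon 5 p"
proof
  assume conv: "convex_polygon 5 p"
  define x y where "x = cos (2 * pi / 5)" and "y = sin (2 * pi / 5)"
  have x0: "x > 0" and x2: "4 * x\<^sup>2 + 2 * x - 1 = 0" unfolding x_def by (rule cos_2pi_5_pos, rule cos_2pi_5)
  have eqs: "p 0 = ellipse_point c u v a b t" "p 1 = ellipse_point c u v a b (t + 4 * pi / 5)"
    "p 2 = ellipse_point c u v a b (t + 8 * pi / 5)"
    by (simp_all add: p)
  have "t + real 3 * (2 * real 2 * pi / real 5) = (t + 2 * pi / 5) + 2 * pi" by simp
  hence p3: "p 3 = ellipse_point c u v a b (t + 2 * pi / 5)"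
    using p[of 3] by (simp only: ellipse_point_def sin_periodic cos_periodic)
  have C: "cos t + 2 * x * cos (t + 4 * pi / 5) = cos (t + 2 * pi / 5) + 2 * x * cos (t + 8 * pi / 5)"
    using x2 unfolding cos_add cos_sin_multiples_2pi_5 x_def[symmetric] y_def[symmetric] by algebra
  have S: "sin t + 2 * x * sin (t + 4 * pi / 5) = sin (t + 2 * pi / 5) + 2 * x * sin (t + 8 * pi / 5)"
    using x2 unfolding sin_add cos_sin_multiples_2pi_5 x_def[symmetric] y_def[symmetric] by algebra
  have cross: "p 0 + (2 * x) *\<^sub>R p 1 = p 3 + (2 * x) *\<^sub>R p 2"
  proof (unfold vec_eq_iff, intro allI)
    fix i
    have "(p 0 + (2 * x) *\<^sub>R p 1) $ i = (1 + 2 * x) * c $ i + a * u $ i * (cos t + 2 * x * cos (t + 4 * pi / 5))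
        + b * v $ i * (sin t + 2 * x * sin (t + 4 * pi / 5))"
      unfolding eqs ellipse_point_def by (simp add: algebra_simps)
    moreover have "(p 3 + (2 * x) *\<^sub>R p 2) $ i = (1 + 2 * x) * c $ i
        + a * u $ i * (cos (t + 2 * pi / 5) + 2 * x * cos (t + 8 * pi / 5))
        + b * v $ i * (sin (t + 2 * pi / 5) + 2 * x * sin (t + 8 * pi / 5))"
      unfolding eqs p3 ellipse_point_def by (simp add: algebra_simps)
    ultimately show "(p 0 + (2 * x) *\<^sub>R p 1) $ i = (p 3 + (2 * x) *\<^sub>R p 2) $ i"
      by (simp only: C S)
  qed
  have inj: "inj_on p {..<5}" and edge: "\<And>i. i < 5 \<Longrightarrow> side 5 p i edge_of (convex hull (p ` {..<5}))"
    using conv by (auto simp: convex_polygon_def)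
  have dist: "p i \<noteq> p j" if "i < 5" "j < 5" "i \<noteq> j" for i j using inj that by (auto simp: inj_on_def)
  \<comment> \<open>The crossing point of the two sides: \<open>cross\<close> represents it with the
    same positive weights, in ratio \<open>1 : 2 * x\<close>, on both. As it is inside the segment
    from \<open>p 3\<close> to \<open>p 2\<close>, the face property draws \<open>p 2\<close> into
    side 0.\<close>
  define z where "z = (1 / (1 + 2 * x)) *\<^sub>R (p 0 + (2 * x) *\<^sub>R p 1)"
  have l: "1 - 2 * x / (1 + 2 * x) = 1 / (1 + 2 * x)" "0 < 2 * x / (1 + 2 * x)" "2 * x / (1 + 2 * x) < 1"
    using x0 by (simp_all add: field_simps)
  have z1: "z = (1 - 2 * x / (1 + 2 * x)) *\<^sub>R p 0 + (2 * x / (1 + 2 * x)) *\<^sub>R p 1"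
    unfolding l z_def by (simp add: scaleR_add_right)
  have z2: "z = (1 - 2 * x / (1 + 2 * x)) *\<^sub>R p 3 + (2 * x / (1 + 2 * x)) *\<^sub>R p 2"
    unfolding l z_def cross by (simp add: scaleR_add_right)
  have "side 5 p 0 face_of (convex hull (p ` {..<5}))"
    using edge[of 0] by (simp add: edge_of_def)
  moreover have "p 3 \<in> convex hull (p ` {..<5})" "p 2 \<in> convex hull (p ` {..<5})"
    by (auto intro!: hull_inc)
  moreover have "z \<in> side 5 p 0"
    unfolding side_def in_segment using z1 l by (intro exI[of _ "2 * x / (1 + 2 * x)"]) simp
  moreover have "z \<in> open_segment (p 3) (p 2)"
    unfolding in_segment using z2 l dist[of 3 2] by (intro conjI exI[of _ "2 * x / (1 + 2 * x)"]) simp_all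
  ultimately have "p 2 \<in> side 5 p 0"
    unfolding face_of_def by blast
  then obtain k where k: "p 2 = (1 - k) *\<^sub>R p 0 + k *\<^sub>R p 1"
    unfolding side_def in_segment by auto
  \<comment> \<open>With radius factor 1 the chord criterion says that a chord meets its own ellipse
    only at its ends, so \<open>p 2\<close> would coincide with \<open>p 0\<close> or
    \<open>p 1\<close>.\<close>
  have "1 - 2 * (1 - cos (t - (t + 4 * pi / 5))) * (k * (1 - k)) = 1\<^sup>2"
    if "p 2 \<in> ellipse c u v (1 * a) (1 * b)"
    using that chord_in_ellipse_iff[OF on ab zero_less_one, of k c t "t + 4 * pi / 5"] unfolding k eqs by simp
  moreover have "p 2 \<in> ellipse c u v (1 * a) (1 * b)"
    using chord_in_ellipse_iff[OF on ab zero_less_one, of 0 c "t + 8 * pi / 5" t] unfolding eqs by simp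
  ultimately have "2 * (1 - cos (t - (t + 4 * pi / 5))) * (k * (1 - k)) = 0" by simp
  moreover have "cos (t - (t + 4 * pi / 5)) < 1"
  proof -
    have "cos (4 * pi / 5) < cos 0" by (intro cos_monotone_0_pi) auto
    thus ?thesis by simp
  qed
  ultimately have "k = 0 \<or> k = 1" by simp
  hence "p 2 = p 0 \<or> p 2 = p 1" using k by auto
  thus False using dist[of 2 0] dist[of 2 1] by auto
qed

subsection \<open>Trigonometric sums\<close>

text \<open>\<open>M\<close> is chosen before \<kappa> and \<open>D\<close>, so one value serves
  both foci; it is a quarter of \<open>cos (3 * (t + pi / 3))\<close>. Over the common denominator
  the numerator is the sum of the \<open>D i\<close>, where the cosines cancel.\<close>

lemma sum_inverse_products_3:
  fixes t a :: real
  obtains M where "\<And>\<kappa> D. (\<And>i. D i = a - \<kappa> * cos (t + (2 * real i + 1) * (pi / 3))) \<Longrightarrow> (\<And>i. D i > 0) \<Longrightarrow>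
    (\<Sum>i<3. 1 / (D i * D (Suc i))) = 3 * a / (a ^ 3 - 3 / 4 * a * \<kappa>\<^sup>2 - \<kappa> ^ 3 * M)
    \<and> a ^ 3 - 3 / 4 * a * \<kappa>\<^sup>2 - \<kappa> ^ 3 * M > 0"
proof
  define X Y h where "X = cos (t + pi / 3)" and "Y = sin (t + pi / 3)" and "h = sqrt 3 / 2"
  fix \<kappa> and D :: "nat \<Rightarrow> real"
  assume D: "\<And>i. D i = a - \<kappa> * cos (t + (2 * real i + 1) * (pi / 3))" and pos: "\<And>i. D i > 0"
  have 2: "2 * pi / 3 = pi - pi / 3" and 4: "4 * pi / 3 = pi + pi / 3" by simp_all
  have cs: "cos (2 * pi / 3) = - (1 / 2)" "sin (2 * pi / 3) = h" "cos (4 * pi / 3) = - (1 / 2)" "sin (4 * pi / 3) = - h"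
    unfolding 2 4 cos_diff cos_add sin_diff sin_add h_def by (simp_all add: cos_60 sin_60)
  have ang: "t + (2 * real 1 + 1) * (pi / 3) = (t + pi / 3) + 2 * pi / 3"
    "t + (2 * real 2 + 1) * (pi / 3) = (t + pi / 3) + 4 * pi / 3"
    "t + (2 * real 3 + 1) * (pi / 3) = (t + pi / 3) + 2 * pi" by simp_all
  have D': "D 0 = a - \<kappa> * X" "D 1 = a - \<kappa> * (- (1 / 2) * X - h * Y)" "D 2 = a - \<kappa> * (- (1 / 2) * X + h * Y)" "D 3 = D 0"
    unfolding D ang cos_add[of "t + pi / 3"] cs X_def[symmetric] Y_def[symmetric]
    by (simp_all add: X_def)
  have Y: "Y\<^sup>2 = 1 - X\<^sup>2" and h: "h\<^sup>2 = 3 / 4"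
    by (simp_all add: X_def Y_def h_def sin_squared_eq power_divide)
  have prod: "D 0 * D 1 * D 2 = a ^ 3 - 3 / 4 * a * \<kappa>\<^sup>2 - \<kappa> ^ 3 * (X ^ 3 - 3 / 4 * X)"
    unfolding D' using Y h by algebra
  have "(\<Sum>i<3. 1 / (D i * D (Suc i))) = 1 / (D 0 * D 1) + 1 / (D 1 * D 2) + 1 / (D 2 * D 0)"
    using D'(4) by (simp add: eval_nat_numeral)
  also have "\<dots> = (D 0 + D 1 + D 2) / (D 0 * D 1 * D 2)"
    using pos[of 0] pos[of 1] pos[of 2] by (simp add: divide_simps)
  also have "D 0 + D 1 + D 2 = 3 * a" unfolding D' by (simp add: algebra_simps)
  finally show "(\<Sum>i<3. 1 / (D i * D (Suc i))) = 3 * a / (a ^ 3 - 3 / 4 * a * \<kappa>\<^sup>2 - \<kappa> ^ 3 * (X ^ 3 - 3 / 4 * X))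
    \<and> a ^ 3 - 3 / 4 * a * \<kappa>\<^sup>2 - \<kappa> ^ 3 * (X ^ 3 - 3 / 4 * X) > 0"
    unfolding prod[symmetric] using pos by simp
qed

text \<open>Again \<open>M\<close> depends on \<open>t\<close> alone: it is
  \<open>cos (5 * (t + pi / 5)) / 16\<close>. The numerator is the cyclic sum of products of three
  consecutive \<open>D i\<close>.\<close>

lemma sum_inverse_products_5:
  fixes t a :: real
  obtains M where "\<And>\<kappa> D. (\<And>i. D i = a - \<kappa> * cos (t + (2 * real i + 1) * (pi / 5))) \<Longrightarrow> (\<And>i. D i > 0) \<Longrightarrow>
    (\<Sum>i<5. 1 / (D i * D (Suc i)))
      = (5 * a ^ 3 + 5 / 2 * a * \<kappa>\<^sup>2 * (cos (2 * pi / 5) - 1 / 2)) / (a ^ 5 - 5 / 4 * a ^ 3 * \<kappa>\<^sup>2 + 5 / 16 * a * \<kappa> ^ 4 - \<kappa> ^ 5 * M)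
    \<and> a ^ 5 - 5 / 4 * a ^ 3 * \<kappa>\<^sup>2 + 5 / 16 * a * \<kappa> ^ 4 - \<kappa> ^ 5 * M > 0"
proof
  define X Y x y where "X = cos (t + pi / 5)" and "Y = sin (t + pi / 5)"
    and "x = cos (2 * pi / 5)" and "y = sin (2 * pi / 5)"
  let ?M = "X ^ 5 - 5 / 4 * X ^ 3 + 5 / 16 * X"
  fix \<kappa> and D :: "nat \<Rightarrow> real"
  assume D: "\<And>i. D i = a - \<kappa> * cos (t + (2 * real i + 1) * (pi / 5))" and pos: "\<And>i. D i > 0"
  have x2: "4 * x\<^sup>2 + 2 * x - 1 = 0" unfolding x_def by (rule cos_2pi_5)
  have Y: "Y\<^sup>2 = 1 - X\<^sup>2" and y: "y\<^sup>2 = 1 - x\<^sup>2"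
    by (simp_all add: X_def Y_def x_def y_def sin_squared_eq)
  have ang: "t + (2 * real 1 + 1) * (pi / 5) = (t + pi / 5) + 2 * pi / 5"
    "t + (2 * real 2 + 1) * (pi / 5) = (t + pi / 5) + 4 * pi / 5"
    "t + (2 * real 3 + 1) * (pi / 5) = (t + pi / 5) + 6 * pi / 5"
    "t + (2 * real 4 + 1) * (pi / 5) = (t + pi / 5) + 8 * pi / 5"
    "t + (2 * real 5 + 1) * (pi / 5) = (t + pi / 5) + 2 * pi" by simp_all
  define P1 P2 R1 R2 where "P1 = a - \<kappa> * (X * x)" and "P2 = a - \<kappa> * (X * (2 * x\<^sup>2 - 1))"
    and "R1 = \<kappa> * (Y * y)" and "R2 = \<kappa> * (Y * (2 * y * x))"
  \<comment> \<open>Contact points symmetric about the diameter through the first one of the regular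
    pentagon give conjugate factors, so the products involve only \<open>P1\<close>,
    \<open>P2\<close>, the squares of \<open>R1\<close>, \<open>R2\<close> and
    \<open>R1 * R2\<close>.\<close>
  have D': "D 0 = a - \<kappa> * X" "D 1 = P1 + R1" "D 2 = P2 + R2" "D 3 = P2 - R2" "D 4 = P1 - R1" "D 5 = D 0"
    unfolding D ang cos_add[of "t + pi / 5"] cos_sin_multiples_2pi_5 P1_def P2_def R1_def R2_def
      x_def[symmetric] y_def[symmetric] X_def[symmetric] Y_def[symmetric]
    by (simp_all add: X_def algebra_simps)
  have P2: "P2 = a + \<kappa> * X * (x + 1 / 2)" unfolding P2_def using x2 by algebra
  have R12: "R1 * R2 = \<kappa>\<^sup>2 * (1 - X\<^sup>2) * (x + 1 / 4)"
  proof -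
    have "R1 * R2 = \<kappa>\<^sup>2 * Y\<^sup>2 * (2 * y\<^sup>2 * x)" by (simp add: R1_def R2_def power2_eq_square)
    also have "2 * y\<^sup>2 * x = x + 1 / 4" using y x2 by algebra
    finally show ?thesis unfolding Y .
  qed
  have E1: "D 1 * D 4 = a\<^sup>2 - 2 * a * \<kappa> * X * x + \<kappa>\<^sup>2 * (X\<^sup>2 - (3 + 2 * x) / 4)"
  proof -
    have "D 1 * D 4 = P1\<^sup>2 - \<kappa>\<^sup>2 * Y\<^sup>2 * y\<^sup>2"
      unfolding D' R1_def by (simp add: power2_eq_square algebra_simps)
    also have "y\<^sup>2 = (3 + 2 * x) / 4" using y x2 by algebra
    also have "P1\<^sup>2 = a\<^sup>2 - 2 * a * \<kappa> * X * x + \<kappa>\<^sup>2 * X\<^sup>2 * x\<^sup>2"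
      by (simp add: P1_def power2_eq_square algebra_simps)
    also have "x\<^sup>2 = 1 - (3 + 2 * x) / 4" using x2 by algebra
    finally show ?thesis unfolding Y by (simp add: algebra_simps)
  qed
  have E2: "D 2 * D 3 = a\<^sup>2 + 2 * a * \<kappa> * X * (x + 1 / 2) + \<kappa>\<^sup>2 * (X\<^sup>2 - (1 - x) / 2)"
  proof -
    have "D 2 * D 3 = P2\<^sup>2 - \<kappa>\<^sup>2 * Y\<^sup>2 * (4 * y\<^sup>2 * x\<^sup>2)"
      unfolding D' R2_def by (simp add: power2_eq_square algebra_simps)
    also have "4 * y\<^sup>2 * x\<^sup>2 = (1 - x) / 2" using y x2 by algebra
    also have "P2\<^sup>2 = a\<^sup>2 + 2 * a * \<kappa> * X * (x + 1 / 2) + \<kappa>\<^sup>2 * X\<^sup>2 * (x + 1 / 2)\<^sup>2"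
      by (simp add: P2 power2_eq_square algebra_simps)
    also have "(x + 1 / 2)\<^sup>2 = 1 - (1 - x) / 2" using x2 by algebra
    finally show ?thesis unfolding Y by (simp add: algebra_simps)
  qed
  have "D 0 * D 1 * D 2 * D 3 * D 4 = D 0 * (D 1 * D 4) * (D 2 * D 3)" by (simp add: mult_ac)
  also have "\<dots> = a ^ 5 - 5 / 4 * a ^ 3 * \<kappa>\<^sup>2 + 5 / 16 * a * \<kappa> ^ 4 - \<kappa> ^ 5 * ?M"
    unfolding E1 E2 D'(1) using x2 by algebra
  finally have prod: "D 0 * D 1 * D 2 * D 3 * D 4
      = a ^ 5 - 5 / 4 * a ^ 3 * \<kappa>\<^sup>2 + 5 / 16 * a * \<kappa> ^ 4 - \<kappa> ^ 5 * ?M" .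
  \<comment> \<open>Grouped by conjugate pairs: \<open>D 1 + D 4\<close> is \<open>2 * P1\<close>,
    and the two mixed products with \<open>D 0\<close> add up to
    \<open>2 * (P1 * P2 + R1 * R2)\<close>.\<close>
  have "D 2 * D 3 * D 4 + D 3 * D 4 * D 0 + D 4 * D 0 * D 1 + D 0 * D 1 * D 2 + D 1 * D 2 * D 3
      = 2 * (D 2 * D 3) * P1 + D 0 * (D 1 * D 4 + 2 * (P1 * P2 + R1 * R2))"
    unfolding D' by (simp add: algebra_simps)
  also have "\<dots> = 5 * a ^ 3 + 5 / 2 * a * \<kappa>\<^sup>2 * (x - 1 / 2)"
    unfolding E1 E2 D'(1) P2 R12 P1_def using x2 by algebra
  finally have sum: "D 2 * D 3 * D 4 + D 3 * D 4 * D 0 + D 4 * D 0 * D 1 + D 0 * D 1 * D 2 + D 1 * D 2 * D 3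
      = 5 * a ^ 3 + 5 / 2 * a * \<kappa>\<^sup>2 * (x - 1 / 2)" .
  have "(\<Sum>i<5. 1 / (D i * D (Suc i))) = 1 / (D 0 * D 1) + 1 / (D 1 * D 2) + 1 / (D 2 * D 3) + 1 / (D 3 * D 4) + 1 / (D 4 * D 0)"
    using D'(6) by (simp add: eval_nat_numeral)
  also have "\<dots> = (D 2 * D 3 * D 4 + D 3 * D 4 * D 0 + D 4 * D 0 * D 1 + D 0 * D 1 * D 2 + D 1 * D 2 * D 3)
      / (D 0 * D 1 * D 2 * D 3 * D 4)"
    using pos[of 0] pos[of 1] pos[of 2] pos[of 3] pos[of 4] by (simp add: divide_simps) (simp add: algebra_simps)
  finally show "(\<Sum>i<5. 1 / (D i * D (Suc i)))
      = (5 * a ^ 3 + 5 / 2 * a * \<kappa>\<^sup>2 * (cos (2 * pi / 5) - 1 / 2)) / (a ^ 5 - 5 / 4 * a ^ 3 * \<kappa>\<^sup>2 + 5 / 16 * a * \<kappa> ^ 4 - \<kappa> ^ 5 * ?M)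
    \<and> a ^ 5 - 5 / 4 * a ^ 3 * \<kappa>\<^sup>2 + 5 / 16 * a * \<kappa> ^ 4 - \<kappa> ^ 5 * ?M > 0"
    unfolding sum prod[symmetric] x_def[symmetric] using pos by simp
qed

section \<open>Areas for the two foci, for triangles and pentagons\<close>

theorem proposition6:
  fixes N :: nat
    and c u v f\<^sub>1 f\<^sub>2 :: "real^2"
    and a b r A\<^sub>1 A\<^sub>2 :: real
    and E\<^sub>H E\<^sub>h :: "(real^2) set"
    and p :: "nat \<Rightarrow> real^2"
  assumes "N \<in> {3, 5}"
    and "norm u = 1" and "norm v = 1" and "u \<bullet> v = 0"
    and "a \<ge> b" and "b > 0"
    and "0 < r" and "r < 1"
    and "E\<^sub>H = ellipse c u v a b"
    and "E\<^sub>h = ellipse c u v (r * a) (r * b)"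
    and "{f\<^sub>1, f\<^sub>2} = ellipse_foci c u (r * a) (r * b)"
    and "p \<in> convex_poncelet_family N E\<^sub>H E\<^sub>h"
    and "A\<^sub>1 = polygon_area N (polar_image N f\<^sub>1 1 p)"
    and "A\<^sub>2 = polygon_area N (polar_image N f\<^sub>2 1 p)"
  shows "harmonic_polygon N (polar_image N f\<^sub>1 1 p)
    \<and> harmonic_polygon N (polar_image N f\<^sub>2 1 p)
    \<and> (N = 3 \<longrightarrow> 1 / A\<^sub>1 + 1 / A\<^sub>2 = sqrt 3 / 18 * (b / a) * (a^2 + 3 * b^2))
    \<and> (N = 5 \<longrightarrow> 1 / A\<^sub>1 + 1 / A\<^sub>2 =
         b / (40 * sin (2 * pi / 5) * a)
         * ((a^4 + 10 * a^2 * b^2 + 5 * b^4)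
              * (sqrt 5 * (a^2 + 3 * b^2) + 5 * a^2 + 7 * b^2)
            / (5 * a^4 + 10 * a^2 * b^2 + b^4)))"
proof -
  have ab: "a > 0" "b > 0" and N3: "3 \<le> N" using assms by auto
  have conv: "convex_polygon N p"
    and int: "interscribed N p (ellipse c u v a b) (ellipse c u v (r * a) (r * b))"
    using assms by (simp_all add: convex_poncelet_family_def)
  have inj: "inj_on p {..<N}" using conv by (simp add: convex_polygon_def)
  obtain e t :: real and k :: nat where e: "e = 1 \<or> e = -1" and k: "0 < k" "2 * k < N"
    and rk: "r = cos (k * pi / N)"
    and pk: "\<And>i. i < N \<Longrightarrow> p i = ellipse_point c u (e *\<^sub>R v) a b (t + i * (2 * k * pi / N))"
    by (rule interscribed_homothetic_angles[OF assms(2-4) ab assms(7,8) N3 inj int]) blast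
  define w where "w = e *\<^sub>R v"
  have on: "norm u = 1" "norm w = 1" "u \<bullet> w = 0" using assms e by (auto simp: w_def)
  have "k \<noteq> 2"
  proof
    assume "k = 2"
    hence "N = 5" using k assms(1) by auto
    have "\<not> convex_polygon 5 p"
      by (rule pentagram_not_convex[OF on ab]) (use pk \<open>k = 2\<close> \<open>N = 5\<close> in \<open>simp add: w_def\<close>)
    thus False using conv \<open>N = 5\<close> by simp
  qed
  hence k1: "k = 1" using k assms(1) by auto
  have r: "r = cos (pi / N)" using rk k1 by simp
  have p: "\<forall>i<N. p i = c + (a * cos (t + 2 * real i * (pi / N))) *\<^sub>R u + (b * sin (t + 2 * real i * (pi / N))) *\<^sub>R w"
    using pk by (simp add: k1 ellipse_point_def w_def mult.assoc mult.left_commute)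
  have "sqrt ((r * a)\<^sup>2 - (r * b)\<^sup>2) = sqrt (r\<^sup>2 * (a\<^sup>2 - b\<^sup>2))" by (simp add: algebra_simps)
  also have "\<dots> = r * sqrt (a\<^sup>2 - b\<^sup>2)" using assms by (simp add: real_sqrt_mult)
  finally have "{f\<^sub>1, f\<^sub>2} = {c + (r * sqrt (a\<^sup>2 - b\<^sup>2)) *\<^sub>R u, c + (r * - sqrt (a\<^sup>2 - b\<^sup>2)) *\<^sub>R u}"
    using assms(11) by (simp add: ellipse_foci_def)
  moreover have "(sqrt (a\<^sup>2 - b\<^sup>2))\<^sup>2 = a\<^sup>2 - b\<^sup>2" using assms by (simp add: power_mono)
  \<comment> \<open>The foci may be named in either order; the sign of \<kappa> records which one is
    \<open>f\<^sub>1\<close>.\<close>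
  ultimately obtain \<kappa> where \<kappa>: "\<kappa>\<^sup>2 = a\<^sup>2 - b\<^sup>2" and f: "f\<^sub>1 = c + (r * \<kappa>) *\<^sub>R u" "f\<^sub>2 = c + (r * - \<kappa>) *\<^sub>R u"
    unfolding doubleton_eq_iff by (metis minus_minus power2_minus)
  have \<kappa>': "(- \<kappa>)\<^sup>2 = a\<^sup>2 - b\<^sup>2" using \<kappa> by simp
  define K where "K = a * sin (2 * pi / N) / (2 * r\<^sup>2 * b)"
  note polar1 = polar_image_of_regular[OF on ab \<kappa> N3 r f(1) p, folded K_def]
    and polar2 = polar_image_of_regular[OF on ab \<kappa>' N3 r f(2) p, folded K_def]
  define D1 D2 where "D1 = (\<lambda>i. a - \<kappa> * cos (t + (2 * real i + 1) * (pi / N)))"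
    and "D2 = (\<lambda>i. a - - \<kappa> * cos (t + (2 * real i + 1) * (pi / N)))"
  have A: "A\<^sub>1 = K * (\<Sum>i<N. 1 / (D1 i * D1 (Suc i)))" "A\<^sub>2 = K * (\<Sum>i<N. 1 / (D2 i * D2 (Suc i)))"
    unfolding assms(13,14) D1_def D2_def by (rule polar1(2), rule polar2(2))
  have D: "D1 i > 0" "D2 i > 0" for i unfolding D1_def D2_def by (rule polar1(3), rule polar2(3))
  have "1 / A\<^sub>1 + 1 / A\<^sub>2 = sqrt 3 / 18 * (b / a) * (a^2 + 3 * b^2)" if N: "N = 3"
  proof -
    obtain M where M: "\<And>\<kappa> D. (\<And>i. D i = a - \<kappa> * cos (t + (2 * real i + 1) * (pi / 3))) \<Longrightarrow> (\<And>i. D i > 0) \<Longrightarrow>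
      (\<Sum>i<3. 1 / (D i * D (Suc i))) = 3 * a / (a ^ 3 - 3 / 4 * a * \<kappa>\<^sup>2 - \<kappa> ^ 3 * M)
      \<and> a ^ 3 - 3 / 4 * a * \<kappa>\<^sup>2 - \<kappa> ^ 3 * M > 0"
      by (rule sum_inverse_products_3[where t = t and a = a]) blast
    have "1 / A\<^sub>1 = (a ^ 3 - 3 / 4 * a * \<kappa>\<^sup>2 - \<kappa> ^ 3 * M) / (K * (3 * a))"
      using M[of D1 \<kappa>] D unfolding A N by (simp add: D1_def N)
    moreover have "1 / A\<^sub>2 = (a ^ 3 - 3 / 4 * a * (- \<kappa>)\<^sup>2 - (- \<kappa>) ^ 3 * M) / (K * (3 * a))"
      using M[of D2 "- \<kappa>"] D unfolding A N by (simp add: D2_def N)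
    ultimately have "1 / A\<^sub>1 + 1 / A\<^sub>2 = (2 * a ^ 3 - 3 / 2 * a * \<kappa>\<^sup>2) / (K * (3 * a))"
      by (simp add: power3_eq_cube flip: add_divide_distrib)
    also have "K = sqrt 3 * a / b"
    proof -
      have "2 * pi / 3 = pi - pi / 3" by simp
      hence "sin (2 * pi / 3) = sqrt 3 / 2" by (simp only: sin_pi_minus sin_60)
      thus ?thesis unfolding K_def r N by (simp add: cos_60 power2_eq_square)
    qed
    also have "(2 * a ^ 3 - 3 / 2 * a * \<kappa>\<^sup>2) / (sqrt 3 * a / b * (3 * a)) = sqrt 3 / 18 * (b / a) * (a^2 + 3 * b^2)"
    proof -
      have num: "2 * a ^ 3 - 3 / 2 * a * \<kappa>\<^sup>2 = a * (a\<^sup>2 + 3 * b\<^sup>2) / 2"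
        using \<kappa> by algebra
      have "a * (a\<^sup>2 + 3 * b\<^sup>2) / 2 / (sqrt 3 * a / b * (3 * a)) = 1 / sqrt 3 * (b * (a\<^sup>2 + 3 * b\<^sup>2) / (6 * a))"
        using ab by (simp add: divide_simps)
      also have "1 / sqrt 3 = sqrt 3 / 3" by (simp add: field_simps)
      finally show ?thesis unfolding num by simp
    qed
    finally show ?thesis .
  qed
  moreover have "1 / A\<^sub>1 + 1 / A\<^sub>2 = b / (40 * sin (2 * pi / 5) * a)
         * ((a^4 + 10 * a^2 * b^2 + 5 * b^4)
              * (sqrt 5 * (a^2 + 3 * b^2) + 5 * a^2 + 7 * b^2)
            / (5 * a^4 + 10 * a^2 * b^2 + b^4))" if N: "N = 5"
  proof -
    define x S W H G where "x = cos (2 * pi / 5)"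
      and "S = 5 * a ^ 3 + 5 / 2 * a * \<kappa>\<^sup>2 * (x - 1 / 2)"
      and "W = a^4 + 10 * a^2 * b^2 + 5 * b^4" and "H = 5 * a^4 + 10 * a^2 * b^2 + b^4"
      and "G = sqrt 5 * (a^2 + 3 * b^2) + 5 * a^2 + 7 * b^2"
    have x2: "4 * x\<^sup>2 + 2 * x - 1 = 0" and x0: "x > 0" and s5: "sqrt 5 = 4 * x + 1"
      unfolding x_def by (rule cos_2pi_5, rule cos_2pi_5_pos, rule sqrt_5_eq)
    obtain M where M: "\<And>\<kappa> D. (\<And>i. D i = a - \<kappa> * cos (t + (2 * real i + 1) * (pi / 5))) \<Longrightarrow> (\<And>i. D i > 0) \<Longrightarrow>
      (\<Sum>i<5. 1 / (D i * D (Suc i)))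
        = (5 * a ^ 3 + 5 / 2 * a * \<kappa>\<^sup>2 * (cos (2 * pi / 5) - 1 / 2)) / (a ^ 5 - 5 / 4 * a ^ 3 * \<kappa>\<^sup>2 + 5 / 16 * a * \<kappa> ^ 4 - \<kappa> ^ 5 * M)
      \<and> a ^ 5 - 5 / 4 * a ^ 3 * \<kappa>\<^sup>2 + 5 / 16 * a * \<kappa> ^ 4 - \<kappa> ^ 5 * M > 0"
      by (rule sum_inverse_products_5[where t = t and a = a]) blast
    have "1 / A\<^sub>1 = (a ^ 5 - 5 / 4 * a ^ 3 * \<kappa>\<^sup>2 + 5 / 16 * a * \<kappa> ^ 4 - \<kappa> ^ 5 * M) / (K * S)"
      using M[of D1 \<kappa>] D unfolding A N S_def x_def by (simp add: D1_def N)
    moreover have "1 / A\<^sub>2 = (a ^ 5 - 5 / 4 * a ^ 3 * \<kappa>\<^sup>2 + 5 / 16 * a * \<kappa> ^ 4 + \<kappa> ^ 5 * M) / (K * S)"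
      using M[of D2 "- \<kappa>"] D unfolding A N S_def x_def by (simp add: D2_def N)
    ultimately have "1 / A\<^sub>1 + 1 / A\<^sub>2 = 2 * (a ^ 5 - 5 / 4 * a ^ 3 * \<kappa>\<^sup>2 + 5 / 16 * a * \<kappa> ^ 4) / (K * S)"
      by (simp flip: add_divide_distrib)
    also have "2 * (a ^ 5 - 5 / 4 * a ^ 3 * \<kappa>\<^sup>2 + 5 / 16 * a * \<kappa> ^ 4) = a * W / 8"
      unfolding W_def using \<kappa> by algebra
    finally have sum: "1 / A\<^sub>1 + 1 / A\<^sub>2 = a * W / 8 / (K * S)" .
    have r2: "r\<^sup>2 = (1 + x) / 2"
      using cos_double_cos[of "pi / 5"] unfolding r N x_def by (simp add: field_simps)
    \<comment> \<open>This rationalizes the denominator: \<open>S\<close> is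
      \<open>5 * a / 8\<close> times \<open>5 * a\<^sup>2 + 3 * b\<^sup>2 + sqrt 5 * (a\<^sup>2 -
      b\<^sup>2)\<close>, \<open>G\<close> is \<open>(3 + sqrt 5) / 2\<close> times the conjugate of
      that expression, and the product of the two conjugates is \<open>4 * H\<close>.\<close>
    have GS: "G * S = 5 * a * (1 + x) * H"
      unfolding G_def S_def H_def s5 using \<kappa> x2 by algebra
    have pos: "G > 0" "H > 0" "sin (2 * pi / 5) > 0"
      unfolding G_def H_def using ab by (auto intro!: add_pos_pos mult_pos_pos sin_gt_zero)
    have "S > 0"
    proof -
      have "G * S > 0" unfolding GS using ab pos x0 by simp
      thus ?thesis using pos by (simp add: zero_less_mult_iff)
    qed
    have "a * W / 8 / (K * S) = b * W * (1 + x) / (8 * sin (2 * pi / 5) * S)"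
      unfolding K_def r2 N using ab pos \<open>S > 0\<close> x0 by (simp add: field_simps)
    also have "\<dots> = b * W * G / (40 * a * sin (2 * pi / 5) * H)"
    proof -
      have "(1 + x) / S = G / (5 * a * H)" using GS pos \<open>S > 0\<close> ab by (simp add: field_simps)
      hence "b * W / (8 * sin (2 * pi / 5)) * ((1 + x) / S) = b * W / (8 * sin (2 * pi / 5)) * (G / (5 * a * H))"
        by simp
      thus ?thesis by (simp add: mult_ac)
    qed
    finally have "1 / A\<^sub>1 + 1 / A\<^sub>2 = b / (40 * sin (2 * pi / 5) * a) * (W * G / H)"
      unfolding sum by (simp add: mult_ac)
    thus ?thesis unfolding W_def G_def H_def .
  qed
  ultimately show ?thesis using polar1(1) polar2(1) by blast
qed

end
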